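(* Suppose that $\{\varphi_i\}_{i=1}^\kappa$ is a conformal iterated function system, $\Gamma\subset\Sigma$ is a compact set satisfying $\sigma(\Gamma)\subset\Gamma$, and $\{\varphi_{\mathtt{i}}(W) : \mathtt{i}\in\Gamma_*\}$ is the associated Moran construction, with projection $\pi\colon\Gamma\to\mathbb{R}^d$. If the Moran construction satisfies the uniform finite clustering property and there are constants $C\ge1$ and $0<\overline{\alpha}<1$ so that $$C^{-1}\overline{\alpha}^{|\mathtt{i}|} \le \operatorname{diam}(\varphi_{\mathtt{i}}(W)) \le C\overline{\alpha}^{|\mathtt{i}|}$$ for all $\mathtt{i}\in\Gamma_*$, then $$\dim_{\mathrm A}(\pi(A)) = \sup\{\dim_{\mathrm H}(\pi(A')) : A' \text{ is a microset of } A\}$$ for all compact sets $A\subset\Gamma$.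
   Context: Shift space: $\kappa\ge2$, $\Sigma=\{1,\ldots,\kappa\}^{\mathbb{N}}$, with the metric in which two distinct words are at distance $2^{-n}$, $n$ being the first place at which they differ; $\sigma$ is the left shift. $\mathtt{i}|_n$ is the word of the first $n$ letters of $\mathtt{i}$, $\mathtt{i}|_0=\varnothing$ is the empty word. $\Sigma_*$ is the set of all finite words; for $\Gamma\subset\Sigma$, $\Gamma_n=\{\mathtt{i}|_n:\mathtt{i}\in\Gamma\}$ and $\Gamma_*=\bigcup_{n=0}^\infty\Gamma_n$. $|\mathtt{i}|$ is the length of $\mathtt{i}$, $\mathtt{i}^-$ is the non-empty finite word $\mathtt{i}$ with last letter removed, and $[\mathtt{i}]=\{\mathtt{i}\mathtt{j}:\mathtt{j}\in\Sigma\}$. Conformal iterated function system (standard notion): a finite family $\{\varphi_i\}_{i=1}^\kappa$ of injective Lipschitz contractions of a compact set $X\subset\mathbb{R}^d$ into itself, not all having the same fixed point, such that there is a bounded open connected set $V\supset X$ to which each $\varphi_i$ extends as an injective $C^{1+\varepsilon}$ conformal map $V\to V$ (its derivative at every point is a non-zero multiple of an orthogonal map) with $\sup_{x\in V}|\varphi_i'(x)|<1$. For $\mathtt{i}=i_1\cdots i_n$, $\varphi_{\mathtt{i}}=\varphi_{i_1}\circ\cdots\circ\varphi_{i_n}$ and $\varphi_\varnothing=\mathrm{id}$. Associated Moran construction: $W\subset X$ is a closed bounded set of positive diameter with $\varphi_i(W)\subset W$ for all $i$, and $E_{\mathtt{i}}=\varphi_{\mathtt{i}}(W)$ for $\mathtt{i}\in\Gamma_*$.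 The projection is defined by $\{\pi(\mathtt{i})\}=\bigcap_{n=1}^\infty E_{\mathtt{i}|_n}$ for $\mathtt{i}\in\Gamma$; the limit set is $E=\pi(\Gamma)$. Uniform finite clustering property: $\Gamma(r)=\{\mathtt{i}\in\Gamma_*\setminus\{\varnothing\}:\operatorname{diam}(E_{\mathtt{i}})\le r<\operatorname{diam}(E_{\mathtt{i}^-})\}$, $\Gamma(x,r)=\{\mathtt{i}\in\Gamma(r):E_{\mathtt{i}}\cap B(x,r)\ne\emptyset\}$ with $B(x,r)$ the closed ball; the property is $\sup_{x\in E}\sup_{r>0}\#\Gamma(x,r)<\infty$. Microsets: for $A\subset\Gamma$ and $\mathtt{i}\in\Sigma_*$ let $\beta_{\mathtt{i}}(A)=\sigma^{|\mathtt{i}|}(A\cap[\mathtt{i}])$. Sets of the form $\beta_{\mathtt{i}}(A)$ are the minisets of $A$. A set $A'\subset\Gamma$ is a microset of a compact set $A\subset\Gamma$ if there is a sequence of minisets of $A$ converging to $A'$ in the Hausdorff metric (the empty set being an isolated point, and having dimension $0$). Dimensions: $\dim_{\mathrm H}$ is Hausdorff dimension. The Assouad dimension $\dim_{\mathrm A}(A)$ is the infimum of all $t\ge 0$ for which there is $C\ge1$ such that for all $x \in A$ and $0<r<R$ the set $A\cap B(x,R)$ can be covered by at most $C(r/R)^{-t}$ balls of radius $r$ centered at $A$. *)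

theory Defs
  imports "HOL-Analysis.Analysis" "HOL-Library.Stream"
begin

section \<open>The shift space\<close>

text \<open>Infinite words are streams and finite words are lists over the alphabet
  \<open>{1..\<kappa>}\<close>; \<open>stake n i\<close> is the initial word of length \<open>n\<close>, \<open>stl\<close> the left shift and
  \<open>sdrop n\<close> its \<open>n\<close>-th iterate.\<close>

definition shift_space :: "nat \<Rightarrow> nat stream set" where
  "shift_space \<kappa> = streams {1..\<kappa>}"

text \<open>Streams are indexed from \<open>0\<close> but the places of a word are counted from \<open>1\<close>, hence
  the \<open>Suc\<close>.\<close>

definition shift_dist :: "nat stream \<Rightarrow> nat stream \<Rightarrow> real" where
  "shift_dist i j = (if i = j then 0 else (1/2) ^ Suc (LEAST n. i !! n \<noteq> j !! n))"

lemma shift_dist_sym: "shift_dist i j = shift_dist j i"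
  by (auto simp: shift_dist_def eq_commute)

lemma shift_dist_ultrametric: "shift_dist i k \<le> max (shift_dist i j) (shift_dist j k)"
proof (cases "i = j \<or> j = k \<or> i = k")
  case True
  then show ?thesis
    by (auto simp: shift_dist_def le_max_iff_disj)
next
  case False
  define n where "n = (LEAST n. i !! n \<noteq> k !! n)"
  have ex: "\<exists>n. i !! n \<noteq> k !! n" using False by (metis ext stream_smap_nats)
  have n: "i !! n \<noteq> k !! n" unfolding n_def using ex by (rule LeastI_ex)
  then have "i !! n \<noteq> j !! n \<or> j !! n \<noteq> k !! n" by metis
  then have "(LEAST n. i !! n \<noteq> j !! n) \<le> n \<or> (LEAST n. j !! n \<noteq> k !! n) \<le> n"
    by (meson Least_le)
  then have "(1/2::real) ^ Suc n \<le> (1/2) ^ Suc (LEAST n. i !! n \<noteq> j !! n) \<or>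
      (1/2::real) ^ Suc n \<le> (1/2) ^ Suc (LEAST n. j !! n \<noteq> k !! n)"
    by (auto intro!: power_decreasing)
  then show ?thesis
    using False by (simp add: shift_dist_def n_def le_max_iff_disj del: power_Suc)
qed

lemma Metric_space_shift: "Metric_space S shift_dist"
proof
  show "0 \<le> shift_dist i j" for i j by (simp add: shift_dist_def)
  then show "shift_dist i k \<le> shift_dist i j + shift_dist j k" for i j k
    using shift_dist_ultrametric[of i k j] by (smt (verit))
  show "shift_dist i j = 0 \<longleftrightarrow> i = j" for i j by (simp add: shift_dist_def)
qed (rule shift_dist_sym)

definition shift_compact :: "nat \<Rightarrow> nat stream set \<Rightarrow> bool" where
  "shift_compact \<kappa> A \<longleftrightarrow> compactin (Metric_space.mtopology (shift_space \<kappa>) shift_dist) A"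

definition initial_words :: "nat stream set \<Rightarrow> nat list set" where
  "initial_words \<Gamma> = (\<Union>n. stake n ` \<Gamma>)"

definition cylinder :: "nat \<Rightarrow> nat list \<Rightarrow> nat stream set" where
  "cylinder \<kappa> w = {w @- j | j. j \<in> shift_space \<kappa>}"


section \<open>Minisets and microsets\<close>

definition miniset :: "nat \<Rightarrow> nat list \<Rightarrow> nat stream set \<Rightarrow> nat stream set" where
  "miniset \<kappa> w A = sdrop (length w) ` (A \<inter> cylinder \<kappa> w)"

text \<open>With values in the extended non-negative reals, the distance between the empty set and
  any non-empty set is \<open>\<infinity>\<close>, so that the empty set is isolated.\<close>

definition hausdorff_dist :: "('a \<Rightarrow> 'a \<Rightarrow> real) \<Rightarrow> 'a set \<Rightarrow> 'a set \<Rightarrow> ennreal" where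
  "hausdorff_dist d A B =
     max (SUP x\<in>A. INF y\<in>B. ennreal (d x y)) (SUP y\<in>B. INF x\<in>A. ennreal (d x y))"

text \<open>Microsets are compact because the Hausdorff metric lives on compact sets; without this
  requirement the limit of a sequence would only be determined up to closure.\<close>

definition microset :: "nat \<Rightarrow> nat stream set \<Rightarrow> nat stream set \<Rightarrow> nat stream set \<Rightarrow> bool" where
  "microset \<kappa> \<Gamma> A A' \<longleftrightarrow> A' \<subseteq> \<Gamma> \<and> shift_compact \<kappa> A' \<and>
     (\<exists>w :: nat \<Rightarrow> nat list. (\<forall>n. w n \<in> lists {1..\<kappa>}) \<and>
        (\<lambda>n. hausdorff_dist shift_dist (miniset \<kappa> (w n) A) A') \<longlonglongrightarrow> 0)"


section \<open>Conformal iterated function systems and Moran constructions\<close>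

text \<open>A conformal map of class $C^{1+\varepsilon}$ on \<open>V\<close>: its derivative is
  $\varepsilon$-Hoelder continuous on \<open>V\<close> and everywhere a non-zero multiple of an orthogonal map.\<close>

definition conformal_map_on ::
  "real \<Rightarrow> (real ^ 'd) set \<Rightarrow> (real ^ 'd \<Rightarrow> real ^ 'd) \<Rightarrow> (real ^ 'd \<Rightarrow> (real ^ 'd) \<Rightarrow>\<^sub>L (real ^ 'd)) \<Rightarrow> bool"
where
  "conformal_map_on \<epsilon> V f f' \<longleftrightarrow>
     (\<forall>x\<in>V. (f has_derivative blinfun_apply (f' x)) (at x)) \<and>
     (\<exists>K. \<forall>x\<in>V. \<forall>y\<in>V. norm (f' x - f' y) \<le> K * dist x y powr \<epsilon>) \<and>
     (\<forall>x\<in>V. \<exists>c T. c \<noteq> 0 \<and> orthogonal_transformation T \<and> (\<forall>v. blinfun_apply (f' x) v = c *\<^sub>R T v))"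

text \<open>Only the values of \<open>\<phi> i\<close> on \<open>X\<close> matter; \<open>\<psi> i\<close> is the extension of \<open>\<phi> i\<close> to \<open>V\<close>.\<close>

definition conformal_ifs ::
  "nat \<Rightarrow> (real ^ 'd) set \<Rightarrow> (nat \<Rightarrow> real ^ 'd \<Rightarrow> real ^ 'd) \<Rightarrow> bool" where
  "conformal_ifs \<kappa> X \<phi> \<longleftrightarrow>
     compact X \<and>
     (\<forall>i\<in>{1..\<kappa>}. \<phi> i ` X \<subseteq> X \<and> inj_on (\<phi> i) X \<and> (\<exists>L<1. L-lipschitz_on X (\<phi> i))) \<and>
     \<not> (\<exists>x\<in>X. \<forall>i\<in>{1..\<kappa>}. \<phi> i x = x) \<and>
     (\<exists>V \<epsilon> \<psi> \<psi>'. open V \<and> bounded V \<and> connected V \<and> X \<subseteq> V \<and> 0 < \<epsilon> \<and>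
        (\<forall>i\<in>{1..\<kappa>}.
           (\<forall>x\<in>X. \<psi> i x = \<phi> i x) \<and> \<psi> i ` V \<subseteq> V \<and> inj_on (\<psi> i) V \<and>
           conformal_map_on \<epsilon> V (\<psi> i) (\<psi>' i) \<and>
           (\<exists>c<1. \<forall>x\<in>V. norm (\<psi>' i x) \<le> c)))"

definition word_map :: "(nat \<Rightarrow> 'a \<Rightarrow> 'a) \<Rightarrow> nat list \<Rightarrow> 'a \<Rightarrow> 'a" where
  "word_map \<phi> w = foldr (\<lambda>i f. \<phi> i \<circ> f) w id"

definition moran_set :: "(nat \<Rightarrow> 'a \<Rightarrow> 'a) \<Rightarrow> 'a set \<Rightarrow> nat list \<Rightarrow> 'a set" where
  "moran_set \<phi> W w = word_map \<phi> w ` W"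

definition moran_proj :: "(nat \<Rightarrow> 'a \<Rightarrow> 'a) \<Rightarrow> 'a set \<Rightarrow> nat stream \<Rightarrow> 'a" where
  "moran_proj \<phi> W i = (THE x. (\<Inter>n\<in>{1..}. moran_set \<phi> W (stake n i)) = {x})"

definition stopping_words ::
  "nat stream set \<Rightarrow> (nat \<Rightarrow> 'a::metric_space \<Rightarrow> 'a) \<Rightarrow> 'a set \<Rightarrow> real \<Rightarrow> nat list set" where
  "stopping_words \<Gamma> \<phi> W r = {w \<in> initial_words \<Gamma> - {[]}.
     diameter (moran_set \<phi> W w) \<le> r \<and> r < diameter (moran_set \<phi> W (butlast w))}"

definition stopping_words_near ::
  "nat stream set \<Rightarrow> (nat \<Rightarrow> 'a::metric_space \<Rightarrow> 'a) \<Rightarrow> 'a set \<Rightarrow> 'a \<Rightarrow> real \<Rightarrow> nat list set" where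
  "stopping_words_near \<Gamma> \<phi> W x r =
     {w \<in> stopping_words \<Gamma> \<phi> W r. moran_set \<phi> W w \<inter> cball x r \<noteq> {}}"

definition uniform_finite_clustering ::
  "nat stream set \<Rightarrow> (nat \<Rightarrow> 'a::metric_space \<Rightarrow> 'a) \<Rightarrow> 'a set \<Rightarrow> bool" where
  "uniform_finite_clustering \<Gamma> \<phi> W \<longleftrightarrow>
     (\<exists>M. \<forall>x\<in>moran_proj \<phi> W ` \<Gamma>. \<forall>r>0.
        finite (stopping_words_near \<Gamma> \<phi> W x r) \<and> card (stopping_words_near \<Gamma> \<phi> W x r) \<le> M)"


section \<open>Dimensions\<close>

text \<open>The \<open>s\<close>-th power of the diameter, with $0^0 = 1$ for non-empty sets (whereas
  \<open>0 powr 0 = 0\<close>).\<close>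

definition diam_power :: "real \<Rightarrow> 'a::metric_space set \<Rightarrow> ennreal" where
  "diam_power s U = (if U = {} then 0 else if s = 0 then 1 else ennreal (diameter U powr s))"

text \<open>Boundedness of the covering sets is required explicitly since \<open>diameter\<close> is meaningless
  for unbounded sets.\<close>

definition hausdorff_premeasure :: "real \<Rightarrow> real \<Rightarrow> 'a::metric_space set \<Rightarrow> ennreal" where
  "hausdorff_premeasure s \<delta> A =
     Inf {(\<Sum>n. diam_power s (U n)) | U :: nat \<Rightarrow> 'a set.
       A \<subseteq> (\<Union>n. U n) \<and> (\<forall>n. bounded (U n) \<and> diameter (U n) \<le> \<delta>)}"

definition hausdorff_measure :: "real \<Rightarrow> 'a::metric_space set \<Rightarrow> ennreal" where
  "hausdorff_measure s A = (SUP \<delta>\<in>{0<..}. hausdorff_premeasure s \<delta> A)"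

definition hausdorff_dim :: "'a::metric_space set \<Rightarrow> ennreal" where
  "hausdorff_dim A = Inf {ennreal s | s. 0 \<le> s \<and> hausdorff_measure s A = 0}"

definition assouad_dim :: "'a::metric_space set \<Rightarrow> ennreal" where
  "assouad_dim A = Inf {ennreal t | t. 0 \<le> t \<and>
     (\<exists>C\<ge>1. \<forall>x\<in>A. \<forall>r R. 0 < r \<and> r < R \<longrightarrow>
        (\<exists>F. finite F \<and> F \<subseteq> A \<and> real (card F) \<le> C * (r / R) powr (- t) \<and>
             A \<inter> cball x R \<subseteq> (\<Union>y\<in>F. cball y r)))}"

end

theory Submission
  imports Defs "HOL-Library.Diagonal_Subsequence"
begin

text \<open>The theorem is symbolic at heart. Since the sets of the Moran construction at level \<open>n\<close>
  have diameter comparable to \<open>\<alpha> ^ n\<close>, the projection expands by at most a constant factor the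
  metric on \<open>\<Gamma>\<close> in which two words with longest common prefix of length \<open>n\<close> have distance
  \<open>\<alpha> ^ n\<close>; and by the uniform finite clustering property the preimage of a ball is covered by
  boundedly many cylinders that are, up to constants, no larger than the ball. This is the
  locale \<open>symbolic_coding\<close>, and it makes covers of projected sets and covers by cylinders
  interchangeable.

  The covering condition defining the Assouad dimension of the projection of \<open>A\<close> then says
  that the number of words of length \<open>n\<close> in a miniset of \<open>A\<close> is at most a constant times
  \<open>\<alpha> ^ n\<close> to the power \<open>- t\<close>, uniformly over all minisets (\<open>branching_bound\<close>,
  \<open>branching_bound_of_assouad_exponent\<close>, \<open>assouad_exponent_of_branching_bound\<close>). Convergence
  in the Hausdorff metric makes the words of a given length stabilise, so microsets inherit
  this count, and covering by cylinders of equal length bounds the Hausdorff dimension of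
  their projections by \<open>t\<close> (\<open>hausdorff_dim_image_le\<close>).

  Conversely, let the bound fail for the exponent \<open>s\<close>. Then for each \<open>K\<close> there is a miniset
  whose words are spread so evenly that each cylinder of length \<open>k \<le> K\<close> contains at most the
  fraction \<open>(\<alpha> ^ k) powr s\<close> of them (\<open>exists_evenly_branching_node\<close>): by descending into
  cylinders that contain more, the branching bound would follow. A limit of these minisets
  along a diagonal subsequence is a microset in which each finite cover by cylinders of
  lengths \<open>k\<close> satisfies that the sum of \<open>(\<alpha> ^ k) powr s\<close> is at least one
  (\<open>exists_microset_word_cover_sum_ge_1\<close>). By compactness its projection has Hausdorff
  dimension at least \<open>s\<close> (\<open>hausdorff_dim_image_ge\<close>).\<close>

section \<open>Words, cylinders and compactness in the shift space\<close>

lemma stake_eq_mono: "stake n i = stake n j \<Longrightarrow> m \<le> n \<Longrightarrow> stake m i = stake m j"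
  by (metis min.absorb1 take_stake)

lemma stake_eq_iff_snth: "stake n i = stake n j \<longleftrightarrow> (\<forall>m<n. i !! m = j !! m)"
  by (metis length_stake nth_equalityI stake_nth)

lemma shift_dist_less_iff: "shift_dist i j < (1/2) ^ n \<longleftrightarrow> stake n i = stake n j"
proof (cases "i = j")
  case False
  define m where "m = (LEAST m. i !! m \<noteq> j !! m)"
  have "\<exists>m. i !! m \<noteq> j !! m" using False by (metis ext stream_smap_nats)
  then have m: "i !! m \<noteq> j !! m" unfolding m_def by (rule LeastI_ex)
  have below: "i !! k = j !! k" if "k < m" for k
    using that not_less_Least unfolding m_def by blast
  have "stake n i = stake n j \<longleftrightarrow> n < Suc m"
    unfolding stake_eq_iff_snth using m below by (metis less_Suc_eq_le linorder_not_le order_less_le_trans)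
  moreover have "shift_dist i j = (1/2) ^ Suc m"
    using False by (simp add: shift_dist_def m_def)
  moreover have "(1/2::real) ^ Suc m < (1/2) ^ n \<longleftrightarrow> n < Suc m"
    by (rule power_strict_decreasing_iff) auto
  ultimately show ?thesis by (simp only:)
qed (simp add: shift_dist_def)

abbreviation word_cover :: "nat list set \<Rightarrow> nat stream set \<Rightarrow> bool" where
  "word_cover U A \<equiv> (\<forall>i\<in>A. \<exists>u\<in>U. stake (length u) i = u)"

lemma shift_compact_subset: "shift_compact \<kappa> A \<Longrightarrow> A \<subseteq> shift_space \<kappa>"
  using Metric_space.topspace_mtopology[OF Metric_space_shift]
  unfolding shift_compact_def compactin_def by metis

lemma shift_compact_finite_cover:
  assumes "shift_compact \<kappa> A" and "word_cover (\<Union>n. F n) A"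
  shows "\<exists>N. finite N \<and> word_cover (\<Union>n\<in>N. F n) A"
proof -
  interpret S: Metric_space "shift_space \<kappa>" shift_dist by (rule Metric_space_shift)
  define V where "V n = {i \<in> shift_space \<kappa>. \<exists>u\<in>F n. stake (length u) i = u}" for n
  have "openin S.mtopology (V n)" for n
  proof -
    have "\<exists>r>0. S.mball x r \<subseteq> V n" if x: "x \<in> V n" for x
    proof -
      obtain u where u: "u \<in> F n" "stake (length u) x = u" using x V_def by auto
      have "S.mball x ((1/2) ^ length u) \<subseteq> V n"
        using u by (auto simp: V_def shift_dist_less_iff intro!: bexI[of _ u])
      then show ?thesis by (meson half_gt_zero_iff zero_less_one zero_less_power)
    qed
    then show ?thesis by (auto simp: S.openin_mtopology V_def)
  qed
  moreover have "A \<subseteq> \<Union>(range V)"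
    using assms(2) shift_compact_subset[OF assms(1)] by (auto simp: V_def)
  ultimately obtain G where "finite G" "G \<subseteq> range V" "A \<subseteq> \<Union>G"
    using compactinD[OF assms(1)[unfolded shift_compact_def], of "range V"] by blast
  then obtain N where "finite N" "G = V ` N" by (meson finite_subset_image)
  then show ?thesis using \<open>A \<subseteq> \<Union>G\<close> by (auto simp: V_def subset_iff intro!: exI[of _ N])
qed

lemma shift_compact_cluster_point:
  assumes "shift_compact \<kappa> A" and x: "\<And>k::nat. x k \<in> A"
  shows "\<exists>i\<in>A. \<forall>n. infinite {k. stake n (x k) = stake n i}"
proof (rule ccontr)
  assume "\<not> ?thesis"
  then obtain l where l: "\<And>i. i \<in> A \<Longrightarrow> finite {k. stake (l i) (x k) = stake (l i) i}"
    by metis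
  define F where "F i = (if i \<in> A then {stake (l i) i} else {})" for i
  have "word_cover (\<Union>i. F i) A"
  proof
    fix i assume "i \<in> A"
    then show "\<exists>u\<in>\<Union>i. F i. stake (length u) i = u"
      by (intro bexI[of _ "stake (l i) i"]) (auto simp: F_def intro!: exI[of _ i])
  qed
  then obtain N where N: "finite N" "word_cover (\<Union>i\<in>N. F i) A"
    using shift_compact_finite_cover[OF assms(1)] by blast
  have "UNIV \<subseteq> (\<Union>i\<in>N \<inter> A. {k. stake (l i) (x k) = stake (l i) i})"
  proof
    fix k
    obtain i u where "i \<in> N" "u \<in> F i" "stake (length u) (x k) = u" using N(2) x by blast
    then show "k \<in> (\<Union>i\<in>N \<inter> A. {k. stake (l i) (x k) = stake (l i) i})"
      by (auto simp: F_def split: if_splits)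
  qed
  moreover have "finite (\<Union>i\<in>N \<inter> A. {k. stake (l i) (x k) = stake (l i) i})"
    using N(1) l by blast
  ultimately show False using infinite_UNIV_nat finite_subset by blast
qed

text \<open>The condition that all initial words lie in prescribed sets is closed, because cylinders are
  open.\<close>

lemma shift_compact_restrict:
  assumes "shift_compact \<kappa> A"
  shows "shift_compact \<kappa> {i \<in> A. \<forall>n. stake n i \<in> T n}"
proof -
  interpret S: Metric_space "shift_space \<kappa>" shift_dist by (rule Metric_space_shift)
  have cl: "closedin S.mtopology A"
    using assms S.Hausdorff_space_mtopology compactin_imp_closedin unfolding shift_compact_def by blast
  have "closedin S.mtopology {i \<in> shift_space \<kappa>. \<forall>n. stake n i \<in> T n}"
    unfolding S.closedin_metric
  proof (intro conjI allI impI)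
    fix x assume "x \<in> shift_space \<kappa> - {i \<in> shift_space \<kappa>. \<forall>n. stake n i \<in> T n}"
    then obtain n where x: "x \<in> shift_space \<kappa>" "stake n x \<notin> T n" by blast
    have "disjnt {i \<in> shift_space \<kappa>. \<forall>n. stake n i \<in> T n} (S.mball x ((1/2) ^ n))"
      using x by (auto simp: disjnt_iff shift_dist_less_iff)
    then show "\<exists>r>0. disjnt {i \<in> shift_space \<kappa>. \<forall>n. stake n i \<in> T n} (S.mball x r)"
      by (meson half_gt_zero_iff zero_less_one zero_less_power)
  qed auto
  then have "closedin S.mtopology (A \<inter> {i \<in> shift_space \<kappa>. \<forall>n. stake n i \<in> T n})"
    using cl by blast
  moreover have "A \<inter> {i \<in> shift_space \<kappa>. \<forall>n. stake n i \<in> T n} = {i \<in> A. \<forall>n. stake n i \<in> T n}"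
    using shift_compact_subset[OF assms] by blast
  ultimately show ?thesis
    using assms closed_compactin unfolding shift_compact_def by (metis (no_types, lifting) inf_le1)
qed

text \<open>Convergence of sets of words in the Hausdorff metric is stabilisation of their sets of
  initial words of each length.\<close>

lemma hausdorff_dist_shift_le:
  assumes "stake n ` A = stake n ` B"
  shows "hausdorff_dist shift_dist A B \<le> ennreal ((1/2) ^ n)"
proof -
  have *: "(INF y\<in>B. ennreal (shift_dist x y)) \<le> ennreal ((1/2) ^ n)"
    if eq: "stake n ` A \<subseteq> stake n ` B" and "x \<in> A" for x and A B :: "nat stream set"
  proof -
    have "stake n x \<in> stake n ` B" using eq \<open>x \<in> A\<close> by blast
    then obtain y where y: "y \<in> B" "stake n x = stake n y" by (rule imageE)
    then have "ennreal (shift_dist x y) \<le> ennreal ((1/2) ^ n)"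
      using shift_dist_less_iff[of x y n] by (simp add: ennreal_leI)
    with y(1) show ?thesis by (rule INF_lower2)
  qed
  show ?thesis unfolding hausdorff_dist_def
  proof (intro max.boundedI SUP_least)
    show "(INF y\<in>B. ennreal (shift_dist x y)) \<le> ennreal ((1/2) ^ n)" if "x \<in> A" for x
      using *[of A B x] assms that by simp
    show "(INF x\<in>A. ennreal (shift_dist x y)) \<le> ennreal ((1/2) ^ n)" if "y \<in> B" for y
      using *[of B A y] assms that by (simp add: shift_dist_sym)
  qed
qed

lemma stake_image_subset_of_hausdorff_dist:
  assumes "hausdorff_dist shift_dist A B < ennreal ((1/2) ^ n)"
  shows "stake n ` B \<subseteq> stake n ` A"
proof
  fix u assume "u \<in> stake n ` B"
  then obtain y where y: "y \<in> B" "u = stake n y" by blast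
  have "(INF x\<in>A. ennreal (shift_dist x y)) \<le> hausdorff_dist shift_dist A B"
    unfolding hausdorff_dist_def using y(1) by (meson SUP_upper le_max_iff_disj)
  also note assms
  finally obtain x where "x \<in> A" "ennreal (shift_dist x y) < ennreal ((1/2) ^ n)"
    by (auto simp: INF_less_iff)
  then have "shift_dist x y < (1/2) ^ n"
    by (metis ennreal_leI linorder_not_le)
  then show "u \<in> stake n ` A"
    using y(2) \<open>x \<in> A\<close> unfolding shift_dist_less_iff by (metis image_eqI)
qed

section \<open>Branching of trees of words\<close>

text \<open>The tails of the words of \<open>A\<close> after \<open>w\<close>. For sets of words over the alphabet this is the
  miniset of \<open>A\<close> at \<open>w\<close>; unlike the latter it composes along concatenation without any
  reference to the alphabet.\<close>

definition tails :: "nat list \<Rightarrow> nat stream set \<Rightarrow> nat stream set" where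
  "tails w A = {j. w @- j \<in> A}"

text \<open>The symbolic counterpart of the covering condition in the Assouad dimension, for the metric
  in which words with a common prefix of length exactly \<open>n\<close> have distance \<open>\<alpha> ^ n\<close>.\<close>

definition branching_bound :: "real \<Rightarrow> nat stream set \<Rightarrow> real \<Rightarrow> bool" where
  "branching_bound \<alpha> A t \<longleftrightarrow>
     (\<exists>B. \<forall>w n. real (card (stake n ` tails w A)) \<le> B * (\<alpha> ^ n) powr (- t))"

lemma tails_append: "tails (w @ u) A = tails u (tails w A)"
  by (simp add: tails_def)

lemma tails_subset_shift_space: "A \<subseteq> shift_space \<kappa> \<Longrightarrow> tails w A \<subseteq> shift_space \<kappa>"
  by (auto simp: tails_def shift_space_def streams_iff_sset)

lemma lists_of_tails_nonempty:
  assumes "A \<subseteq> shift_space \<kappa>" and "tails w A \<noteq> {}"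
  shows "w \<in> lists {1..\<kappa>}"
proof -
  obtain j where "w @- j \<in> streams {1..\<kappa>}" using assms by (auto simp: tails_def shift_space_def)
  then show ?thesis unfolding streams_iff_sset by auto
qed

lemma miniset_eq_tails:
  assumes "A \<subseteq> shift_space \<kappa>"
  shows "miniset \<kappa> w A = tails w A"
proof -
  have "A \<inter> cylinder \<kappa> w = (@-) w ` tails w A"
    using tails_subset_shift_space[OF assms, of w] by (auto simp: cylinder_def tails_def)
  then show ?thesis by (simp add: miniset_def image_comp comp_def sdrop_shift)
qed

lemma tails_subset_of_shift_invariant: "stl ` \<Gamma> \<subseteq> \<Gamma> \<Longrightarrow> A \<subseteq> \<Gamma> \<Longrightarrow> tails w A \<subseteq> \<Gamma>"
proof (induction w arbitrary: A)
  case (Cons a w)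
  have "tails [a] A \<subseteq> \<Gamma>" using Cons.prems by (force simp: tails_def)
  then show ?case using Cons.IH[of "tails [a] A"] Cons.prems tails_append[of "[a]" w A] by simp
qed (simp add: tails_def)

lemma finite_card_stake_image:
  assumes "A \<subseteq> shift_space \<kappa>"
  shows "finite (stake n ` A)" and "card (stake n ` A) \<le> \<kappa> ^ n"
proof -
  have sub: "stake n ` A \<subseteq> {xs. set xs \<subseteq> {1..\<kappa>} \<and> length xs = n}"
    using assms by (fastforce simp: shift_space_def streams_iff_sset sset_range in_set_conv_nth)
  show "finite (stake n ` A)"
    by (rule finite_subset[OF sub finite_lists_length_eq]) simp
  show "card (stake n ` A) \<le> \<kappa> ^ n"
    using card_mono[OF finite_lists_length_eq sub] card_lists_length_eq[of "{1..\<kappa>}" n] by simp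
qed

text \<open>Failure of the branching bound of exponent \<open>s\<close> yields, for each depth \<open>K\<close>, a miniset whose
  counting measure on words of some length \<open>n \<ge> K\<close> gives each cylinder of length at most \<open>K\<close>
  no more than the proportion that \<open>s\<close>-dimensionality allows. Otherwise one could descend
  repeatedly to a cylinder carrying more than its share; since the remaining length drops by
  at most \<open>K\<close> in each step, the descent stops with fewer than \<open>K\<close> letters left, where the
  number of words is bounded by a constant, and multiplying up the shares gives the
  branching bound.\<close>

lemma exists_evenly_branching_node:
  assumes A: "A \<subseteq> shift_space \<kappa>" and \<alpha>: "0 < \<alpha>" "\<alpha> < 1" and "0 \<le> s"
    and unbounded: "\<not> branching_bound \<alpha> A s"
  shows "\<exists>w n. K \<le> n \<and> tails w A \<noteq> {} \<and>
    (\<forall>u. length u \<le> K \<longrightarrow>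
      real (card (stake (n - length u) ` tails (w @ u) A))
        \<le> (\<alpha> ^ length u) powr s * real (card (stake n ` tails w A)))"
proof (rule ccontr)
  assume none: "\<not> ?thesis"
  define c where "c w n = real (card (stake n ` tails w A))" for w n
  \<comment> \<open>The successor makes the power monotone in the exponent even for an empty alphabet.\<close>
  have "c w n \<le> real (Suc \<kappa> ^ K) * (\<alpha> ^ n) powr (- s)" for w n
  proof (induction n arbitrary: w rule: less_induct)
    case (less n)
    show ?case
    proof (cases "K \<le> n \<and> tails w A \<noteq> {}")
      case True
      then obtain u where u: "length u \<le> K"
        and big: "(\<alpha> ^ length u) powr s * c w n < c (w @ u) (n - length u)"
        using none unfolding c_def by (metis not_le)
      \<comment> \<open>The empty word carries exactly its share, so the descent is proper.\<close>
      have "u \<noteq> []" using big \<alpha> by auto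
      then have IH: "c (w @ u) (n - length u)
          \<le> real (Suc \<kappa> ^ K) * (\<alpha> ^ (n - length u)) powr (- s)"
        using True u by (intro less.IH) (cases u, auto)
      have "\<alpha> ^ n = \<alpha> ^ length u * \<alpha> ^ (n - length u)"
        using u True by (simp flip: power_add)
      then have "(\<alpha> ^ n) powr (- s) = (\<alpha> ^ length u) powr (- s) * (\<alpha> ^ (n - length u)) powr (- s)"
        using \<alpha> by (simp add: powr_mult)
      moreover have "c w n < (\<alpha> ^ length u) powr (- s) * c (w @ u) (n - length u)"
        using big \<alpha> by (simp add: powr_minus_divide pos_less_divide_eq mult.commute)
      moreover have "\<dots> \<le> (\<alpha> ^ length u) powr (- s) * (real (Suc \<kappa> ^ K) * (\<alpha> ^ (n - length u)) powr (- s))"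
        using IH by (intro mult_left_mono) auto
      ultimately show ?thesis by (simp add: mult_ac)
    next
      case False
      have one: "1 \<le> (\<alpha> ^ n) powr (- s)"
        using \<alpha> \<open>0 \<le> s\<close> by (simp add: powr_minus_divide powr_le1 power_le_one)
      have "card (stake n ` tails w A) \<le> Suc \<kappa> ^ K"
      proof (cases "tails w A = {}")
        case False
        then have "n \<le> K" using \<open>\<not> (K \<le> n \<and> tails w A \<noteq> {})\<close> by auto
        have "card (stake n ` tails w A) \<le> \<kappa> ^ n"
          by (rule finite_card_stake_image) (rule tails_subset_shift_space[OF A])
        also have "\<dots> \<le> Suc \<kappa> ^ n" by (rule power_mono) auto
        also have "\<dots> \<le> Suc \<kappa> ^ K" using \<open>n \<le> K\<close> by (rule power_increasing) auto
        finally show ?thesis .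
      qed simp
      then have "c w n \<le> real (Suc \<kappa> ^ K)" unfolding c_def by (rule of_nat_mono)
      also have "\<dots> \<le> real (Suc \<kappa> ^ K) * (\<alpha> ^ n) powr (- s)"
        using one by (simp add: mult_le_cancel_left1)
      finally show ?thesis .
    qed
  qed
  then show False using unbounded unfolding branching_bound_def c_def by blast
qed

text \<open>The mass distribution principle for finite covers: the shares of the covering cylinders add
  up to at least the total mass. Only words of length at most \<open>K\<close> can be used, since longer
  cylinders are not controlled.\<close>

lemma word_cover_sum_ge_1:
  assumes A: "A \<subseteq> shift_space \<kappa>" and "K \<le> n" and ne: "tails w A \<noteq> {}"
    and even: "\<And>u. length u \<le> K \<Longrightarrow>
      real (card (stake (n - length u) ` tails (w @ u) A))
        \<le> (\<alpha> ^ length u) powr s * real (card (stake n ` tails w A))"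
    and G: "finite G" "\<And>u. u \<in> G \<Longrightarrow> length u \<le> K" and cover: "word_cover G (tails w A)"
  shows "1 \<le> (\<Sum>u\<in>G. (\<alpha> ^ length u) powr s)"
proof -
  define c where "c = real (card (stake n ` tails w A))"
  have fin: "finite (stake m ` tails v A)" for m v
    by (rule finite_card_stake_image) (rule tails_subset_shift_space[OF A])
  have "stake n ` tails w A \<subseteq> (\<Union>u\<in>G. (@) u ` stake (n - length u) ` tails (w @ u) A)"
  proof clarify
    fix j assume j: "j \<in> tails w A"
    then obtain u where u: "u \<in> G" "stake (length u) j = u" using cover by blast
    then have "j = u @- sdrop (length u) j" by (metis stake_sdrop)
    then have "sdrop (length u) j \<in> tails (w @ u) A" using j by (simp add: tails_def)
    moreover have "stake n j = u @ stake (n - length u) (sdrop (length u) j)"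
      using u G(2)[OF u(1)] \<open>K \<le> n\<close> by (metis stake_add le_add_diff_inverse order_trans)
    ultimately show "stake n j \<in> (\<Union>u\<in>G. (@) u ` stake (n - length u) ` tails (w @ u) A)"
      using u(1) by blast
  qed
  then have "card (stake n ` tails w A)
      \<le> card (\<Union>u\<in>G. (@) u ` stake (n - length u) ` tails (w @ u) A)"
    using G(1) fin by (intro card_mono) auto
  also have "\<dots> \<le> (\<Sum>u\<in>G. card ((@) u ` stake (n - length u) ` tails (w @ u) A))"
    by (rule card_UN_le[OF G(1)])
  also have "\<dots> \<le> (\<Sum>u\<in>G. card (stake (n - length u) ` tails (w @ u) A))"
    by (intro sum_mono card_image_le fin)
  finally have "c \<le> real (\<Sum>u\<in>G. card (stake (n - length u) ` tails (w @ u) A))"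
    unfolding c_def by (rule of_nat_mono)
  also have "\<dots> = (\<Sum>u\<in>G. real (card (stake (n - length u) ` tails (w @ u) A)))"
    by (rule of_nat_sum)
  also have "\<dots> \<le> (\<Sum>u\<in>G. (\<alpha> ^ length u) powr s * c)"
    unfolding c_def using G(2) even by (intro sum_mono) auto
  finally have "c * 1 \<le> c * (\<Sum>u\<in>G. (\<alpha> ^ length u) powr s)"
    by (simp add: sum_distrib_left mult.commute)
  moreover have "0 < c" unfolding c_def using ne fin by (simp add: card_gt_0_iff)
  ultimately show ?thesis by (simp only: mult_le_cancel_left_pos)
qed

text \<open>Compactness of the space of closed sets, in the form that the traces on the words of each
  length stabilise along a subsequence.\<close>

lemma exists_subseq_stabilising_stakes:
  assumes "\<And>k::nat. B k \<subseteq> shift_space \<kappa>"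
  shows "\<exists>r T. strict_mono r \<and> (\<forall>n. \<forall>k>n. stake n ` B (r k) = T n)"
proof -
  interpret subseqs "\<lambda>n s. \<exists>T. \<forall>k. stake n ` B (s k) = T"
  proof
    fix n and s :: "nat \<Rightarrow> nat" assume "strict_mono s"
    let ?f = "\<lambda>k. stake n ` B (s k)"
    have "range ?f \<subseteq> Pow (stake n ` shift_space \<kappa>)" using assms by auto
    then have "finite (range ?f)"
      by (rule finite_subset) (simp add: finite_card_stake_image(1)[OF order_refl])
    then obtain k0 where inf: "infinite {k. ?f k = ?f k0}"
      using pigeonhole_infinite[of UNIV ?f] by auto
    define e where "e = enumerate {k. ?f k = ?f k0}"
    have "strict_mono e" unfolding e_def using inf by (rule strict_mono_enumerate)
    moreover have "?f (e k) = ?f k0" for k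
      using enumerate_in_set[OF inf, of k] unfolding e_def by blast
    ultimately show "\<exists>r'. strict_mono r' \<and> (\<exists>T. \<forall>k::nat. stake n ` B ((s \<circ> r') k) = T)"
      unfolding comp_def by blast
  qed
  have "\<exists>T. \<forall>k. stake n ` B ((diagseq \<circ> (+) (Suc n)) k) = T" for n
    by (rule diagseq_holds) auto
  then obtain T where T: "\<And>n k. stake n ` B (diagseq (Suc n + k)) = T n" by (auto, metis)
  have "stake n ` B (diagseq k) = T n" if "n < k" for n k
    using T[of n "k - Suc n"] that by simp
  then show ?thesis using subseq_diagseq by blast
qed

text \<open>The lower bound for Hausdorff contents passes to a limit of evenly branching minisets
  without constructing a limit measure: a finite cover only sees initial words up to a
  bounded length, and on these the limit agrees with all late members of the subsequence.\<close>

lemma exists_microset_word_cover_sum_ge_1: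
  assumes \<Gamma>: "shift_compact \<kappa> \<Gamma>" "stl ` \<Gamma> \<subseteq> \<Gamma>" and "A \<subseteq> \<Gamma>"
    and \<alpha>: "0 < \<alpha>" "\<alpha> < 1" and "0 \<le> s" and "\<not> branching_bound \<alpha> A s"
  shows "\<exists>A'. microset \<kappa> \<Gamma> A A' \<and>
    (\<forall>G. finite G \<and> word_cover G A' \<longrightarrow> 1 \<le> (\<Sum>u\<in>G. (\<alpha> ^ length u) powr s))"
proof -
  have A: "A \<subseteq> shift_space \<kappa>" using \<open>A \<subseteq> \<Gamma>\<close> shift_compact_subset[OF \<Gamma>(1)] by blast
  define node where "node K w n \<longleftrightarrow> K \<le> n \<and> tails w A \<noteq> {} \<and>
      (\<forall>u. length u \<le> K \<longrightarrow> real (card (stake (n - length u) ` tails (w @ u) A))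
        \<le> (\<alpha> ^ length u) powr s * real (card (stake n ` tails w A)))" for K w n
  have "\<exists>w n. node K w n" for K
    unfolding node_def
    by (rule exists_evenly_branching_node[OF A \<alpha> \<open>0 \<le> s\<close> \<open>\<not> branching_bound \<alpha> A s\<close>])
  then obtain w n where "\<And>K. node K (w K) (n K)" by metis
  then have wn: "\<And>K. K \<le> n K" "\<And>K. tails (w K) A \<noteq> {}"
    and even: "\<And>K u. length u \<le> K \<Longrightarrow> real (card (stake (n K - length u) ` tails (w K @ u) A))
        \<le> (\<alpha> ^ length u) powr s * real (card (stake (n K) ` tails (w K) A))"
    unfolding node_def by blast+
  define B where "B K = tails (w K) A" for K
  have B\<Gamma>: "B K \<subseteq> \<Gamma>" for K
    unfolding B_def by (rule tails_subset_of_shift_invariant[OF \<Gamma>(2) \<open>A \<subseteq> \<Gamma>\<close>])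
  then have "B K \<subseteq> shift_space \<kappa>" for K
    using shift_compact_subset[OF \<Gamma>(1)] by (rule order_trans)
  from exists_subseq_stabilising_stakes[of B, OF this]
  obtain r T where r: "strict_mono r" and "\<forall>n. \<forall>k>n. stake n ` B (r k) = T n"
    by (elim exE conjE)
  then have T: "\<And>n k. n < k \<Longrightarrow> stake n ` B (r k) = T n" by simp
  define A' where "A' = {i \<in> \<Gamma>. \<forall>n. stake n i \<in> T n}"
  \<comment> \<open>A word of \<open>T n\<close> begins words in all late minisets; a cluster point of these has all its
    initial words in \<open>T\<close>.\<close>
  have A'_T: "stake n ` A' = T n" for n
  proof
    show "stake n ` A' \<subseteq> T n" by (auto simp: A'_def)
    show "T n \<subseteq> stake n ` A'"
    proof
      fix v assume v: "v \<in> T n"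
      have "v \<in> stake n ` B (r (Suc n + k))" for k using v T[of n "Suc n + k"] by simp
      then have "\<exists>x. x \<in> B (r (Suc n + k)) \<and> stake n x = v" for k by (metis imageE)
      then obtain x where x: "\<And>k. x k \<in> B (r (Suc n + k))" "\<And>k. stake n (x k) = v" by metis
      obtain i where i: "i \<in> \<Gamma>" "\<And>m. infinite {k. stake m (x k) = stake m i}"
        using shift_compact_cluster_point[OF \<Gamma>(1), of x] x(1) B\<Gamma> by blast
      have "stake m i \<in> T m" for m
      proof -
        obtain k where k: "m < k" "stake m (x k) = stake m i"
          using i(2)[of m] by (auto simp: infinite_nat_iff_unbounded)
        then show ?thesis using T[of m "Suc n + k"] x(1)[of k] by (metis image_eqI trans_less_add2)
      qed
      then have "i \<in> A'" using i(1) by (simp add: A'_def)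
      moreover have "stake n i = v"
      proof -
        obtain k where "stake n (x k) = stake n i"
          using i(2)[of n] not_finite_existsD by blast
        then show ?thesis using x(2) by simp
      qed
      ultimately show "v \<in> stake n ` A'" by blast
    qed
  qed
  have "microset \<kappa> \<Gamma> A A'"
    unfolding microset_def
  proof (intro conjI exI[of _ "\<lambda>k. w (r k)"] allI)
    show "A' \<subseteq> \<Gamma>" by (auto simp: A'_def)
    show "shift_compact \<kappa> A'" unfolding A'_def by (rule shift_compact_restrict[OF \<Gamma>(1)])
    show "w (r k) \<in> lists {1..\<kappa>}" for k by (rule lists_of_tails_nonempty[OF A wn(2)])
    have le: "hausdorff_dist shift_dist (miniset \<kappa> (w (r (Suc k))) A) A' \<le> ennreal ((1/2) ^ k)" for k
      unfolding miniset_eq_tails[OF A]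
      by (rule hausdorff_dist_shift_le) (use T[of k "Suc k"] A'_T[of k] in \<open>simp add: B_def\<close>)
    have "(\<lambda>k. (1/2::real) ^ k) \<longlonglongrightarrow> 0" by (rule LIMSEQ_power_zero) simp
    then have lim: "(\<lambda>k. ennreal ((1/2) ^ k)) \<longlonglongrightarrow> 0"
      using tendsto_ennrealI[of "\<lambda>k. (1/2::real) ^ k" 0] by (simp only: ennreal_0)
    have "(\<lambda>k. hausdorff_dist shift_dist (miniset \<kappa> (w (r (Suc k))) A) A') \<longlonglongrightarrow> 0"
      by (rule tendsto_sandwich[OF _ _ tendsto_const lim]) (simp_all add: le del: power_one_over)
    then show "(\<lambda>k. hausdorff_dist shift_dist (miniset \<kappa> (w (r k)) A) A') \<longlonglongrightarrow> 0"
      by (rule LIMSEQ_imp_Suc)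
  qed
  moreover have "1 \<le> (\<Sum>u\<in>G. (\<alpha> ^ length u) powr s)" if G: "finite G" "word_cover G A'" for G
  proof -
    define L where "L = Max (insert 0 (length ` G))"
    have L: "length u \<le> L" if "u \<in> G" for u using that G(1) by (simp add: L_def)
    have "L \<le> r (Suc L)" using seq_suble[OF r, of "Suc L"] by simp
    have "word_cover G (tails (w (r (Suc L))) A)"
    proof
      fix j assume "j \<in> tails (w (r (Suc L))) A"
      then have "stake L j \<in> stake L ` A'" using T[of L "Suc L"] A'_T[of L] by (auto simp: B_def)
      then obtain y where "y \<in> A'" "stake L j = stake L y" by (rule imageE)
      then show "\<exists>u\<in>G. stake (length u) j = u" using G(2) L stake_eq_mono by metis
    qed
    with G(1) show ?thesis
      using L \<open>L \<le> r (Suc L)\<close> by (intro word_cover_sum_ge_1[OF A wn(1) wn(2) even]) (auto intro: order_trans)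
  qed
  ultimately show ?thesis by blast
qed

section \<open>Hausdorff and Assouad dimension of coded sets\<close>

lemma diameter_le_of_dist_le:
  fixes S :: "'a::metric_space set"
  assumes "0 \<le> d" and "\<And>x y. x \<in> S \<Longrightarrow> y \<in> S \<Longrightarrow> dist x y \<le> d"
  shows "bounded S" and "diameter S \<le> d"
proof -
  show "bounded S" unfolding bounded_def using assms by blast
  show "diameter S \<le> d"
    using assms by (auto simp: diameter_def intro!: cSUP_least)
qed

lemma hausdorff_premeasure_le_finite_cover:
  fixes P :: "'b \<Rightarrow> 'a::metric_space set"
  assumes "0 \<le> \<delta>" and I: "finite I" and "A \<subseteq> (\<Union>u\<in>I. P u)"
    and P: "\<And>u. u \<in> I \<Longrightarrow> bounded (P u)" "\<And>u. u \<in> I \<Longrightarrow> diameter (P u) \<le> \<delta>"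
  shows "hausdorff_premeasure s \<delta> A \<le> (\<Sum>u\<in>I. diam_power s (P u))"
proof -
  obtain f where f: "bij_betw f {0..<card I} I" using ex_bij_betw_nat_finite[OF I] by blast
  define U where "U m = (if m < card I then P (f m) else {})" for m
  have fI: "f m \<in> I" if "m < card I" for m using f that by (auto simp: bij_betw_def)
  have "(\<Sum>m. diam_power s (U m)) = (\<Sum>m<card I. diam_power s (U m))"
    by (rule suminf_finite) (auto simp: U_def diam_power_def)
  also have "\<dots> = (\<Sum>m\<in>{0..<card I}. diam_power s (P (f m)))"
    by (rule sum.cong) (auto simp: U_def)
  also have "\<dots> = (\<Sum>u\<in>I. diam_power s (P u))"
    by (rule sum.reindex_bij_betw[OF f])
  finally have sum: "(\<Sum>m. diam_power s (U m)) = (\<Sum>u\<in>I. diam_power s (P u))" .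
  have "A \<subseteq> (\<Union>m. U m)"
  proof
    fix x assume "x \<in> A"
    then obtain u where "u \<in> I" "x \<in> P u" using assms(3) by blast
    moreover have "u \<in> f ` {0..<card I}" using f \<open>u \<in> I\<close> by (simp add: bij_betw_def)
    then obtain m where "m < card I" "u = f m" by auto
    ultimately show "x \<in> (\<Union>m. U m)" by (auto simp: U_def)
  qed
  moreover have "bounded (U m) \<and> diameter (U m) \<le> \<delta>" for m
    using P fI \<open>0 \<le> \<delta>\<close> by (auto simp: U_def)
  ultimately show ?thesis
    unfolding hausdorff_premeasure_def sum[symmetric] by (intro Inf_lower) blast
qed

lemma sum_UN_le:
  fixes f :: "'b \<Rightarrow> real"
  assumes "finite N" and "\<And>n. finite (F n)" and "\<And>u. 0 \<le> f u"
  shows "sum f (\<Union>n\<in>N. F n) \<le> (\<Sum>n\<in>N. sum f (F n))"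
  using assms(1)
proof (induction N rule: finite_induct)
  case (insert n N)
  have "sum f (F n \<union> (\<Union>n\<in>N. F n)) \<le> sum f (F n) + sum f (\<Union>n\<in>N. F n)"
    using assms insert.hyps(1) by (subst sum_Un) (auto intro: sum_nonneg)
  then show ?case using insert by simp
qed simp

text \<open>What the dimension theory needs from a Moran construction: up to constants the coding map
  does not increase the distances \<open>\<alpha> ^ n\<close> of the symbolic space, and the part of the
  symbolic space that is coded into a ball is covered by a bounded number of cylinders of at
  most comparable size. The second condition replaces injectivity of the coding map.\<close>

locale symbolic_coding =
  fixes \<kappa> :: nat and \<Gamma> :: "nat stream set" and \<pi> :: "nat stream \<Rightarrow> 'a::metric_space"
    and C \<alpha> :: real and M :: nat
  assumes compact_\<Gamma>: "shift_compact \<kappa> \<Gamma>" and shift_\<Gamma>: "stl ` \<Gamma> \<subseteq> \<Gamma>"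
    and C_ge_1: "1 \<le> C" and \<alpha>_pos: "0 < \<alpha>" and \<alpha>_less_1: "\<alpha> < 1"
    and dist_coding: "\<And>i j n. i \<in> \<Gamma> \<Longrightarrow> j \<in> \<Gamma> \<Longrightarrow> stake n i = stake n j \<Longrightarrow>
      dist (\<pi> i) (\<pi> j) \<le> C * \<alpha> ^ n"
    and ball_word_cover: "\<And>x r. x \<in> \<pi> ` \<Gamma> \<Longrightarrow> 0 < r \<Longrightarrow>
      \<exists>F. finite F \<and> card F \<le> M \<and> (\<forall>u\<in>F. \<alpha> ^ length u \<le> C * r) \<and>
        word_cover F {i \<in> \<Gamma>. dist x (\<pi> i) \<le> r}"
begin

lemma \<Gamma>_shift_space: "\<Gamma> \<subseteq> shift_space \<kappa>"
  by (rule shift_compact_subset[OF compact_\<Gamma>])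

lemma length_power_mono: "m \<le> n \<Longrightarrow> \<alpha> ^ n \<le> \<alpha> ^ m"
  using \<alpha>_pos \<alpha>_less_1 by (intro power_decreasing) auto

lemma length_power_le_iff: "\<alpha> ^ m \<le> \<alpha> ^ n \<longleftrightarrow> n \<le> m"
  using \<alpha>_pos \<alpha>_less_1 by (rule power_decreasing_iff)

text \<open>A cover of the image by small sets is turned into a cover of \<open>A'\<close> by cylinders, at most \<open>M\<close>
  for each covering set, and compactness makes the latter finite.\<close>

lemma hausdorff_dim_image_ge:
  assumes A': "A' \<subseteq> \<Gamma>" "shift_compact \<kappa> A'"
    and cover_sum: "\<And>G. finite G \<Longrightarrow> word_cover G A' \<Longrightarrow> 1 \<le> (\<Sum>u\<in>G. (\<alpha> ^ length u) powr s)"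
  shows "ennreal s \<le> hausdorff_dim (\<pi> ` A')"
  unfolding hausdorff_dim_def
proof (rule Inf_greatest, clarify)
  fix t assume "0 \<le> t" and null: "hausdorff_measure t (\<pi> ` A') = 0"
  show "ennreal s \<le> ennreal t"
  proof (rule ccontr)
    assume "\<not> ?thesis"
    then have "t < s" using ennreal_leI not_le by blast
    have cover_sum_t: "1 \<le> (\<Sum>u\<in>G. (\<alpha> ^ length u) powr t)" if "finite G" "word_cover G A'" for G
    proof -
      have "(\<alpha> ^ length u) powr s \<le> (\<alpha> ^ length u) powr t" for u
        using \<open>t < s\<close> \<alpha>_pos \<alpha>_less_1 by (intro powr_mono') (auto simp: power_le_one)
      then have "(\<Sum>u\<in>G. (\<alpha> ^ length u) powr s) \<le> (\<Sum>u\<in>G. (\<alpha> ^ length u) powr t)"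
        by (intro sum_mono)
      then show ?thesis using cover_sum[OF that] by linarith
    qed
    define D where "D = real M * C powr t"
    define \<eta> where "\<eta> = 1 / (2 * (D + 1))"
    have D: "0 \<le> D" by (simp add: D_def)
    then have \<eta>: "0 < \<eta>" "\<eta> < 1" "D * (2 * \<eta>) < 1" by (auto simp: \<eta>_def field_simps)
    have "hausdorff_premeasure t 1 (\<pi> ` A') \<le> hausdorff_measure t (\<pi> ` A')"
      unfolding hausdorff_measure_def by (rule SUP_upper) simp
    also have "\<dots> < ennreal \<eta>" using null \<eta>(1) by simp
    finally obtain U where U: "\<pi> ` A' \<subseteq> (\<Union>n. U n)" "\<And>n. bounded (U n)"
      and sum_U: "(\<Sum>n. diam_power t (U n)) < ennreal \<eta>"
      unfolding hausdorff_premeasure_def Inf_less_iff by blast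
    define d where "d n = (if U n = {} then 0 else if t = 0 then 1 else diameter (U n) powr t)" for n
    have d: "diam_power t (U n) = ennreal (d n)" for n
      by (simp add: d_def diam_power_def)
    have d_nonneg: "0 \<le> d n" for n by (simp add: d_def)
    have sum_d: "(\<Sum>n\<in>N. d n) < \<eta>" if "finite N" for N
    proof -
      have "ennreal (\<Sum>n\<in>N. d n) = (\<Sum>n\<in>N. diam_power t (U n))"
        by (simp add: d d_nonneg sum_ennreal)
      also have "\<dots> \<le> (\<Sum>n. diam_power t (U n))" by (rule sum_le_suminf) (use that in auto)
      also note sum_U
      finally show ?thesis using \<eta>(1) by (simp add: ennreal_less_iff sum_nonneg d_nonneg)
    qed
    \<comment> \<open>Covering sets may be single points, whereas clustering is about balls of positive radius;
      a summable amount is added to make all radii positive.\<close>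
    define h where "h n = d n + \<eta> * (1/2) ^ Suc n" for n
    have h_pos: "0 < h n" for n using d_nonneg[of n] \<eta>(1) by (simp add: h_def add_nonneg_pos)
    define good where "good n F \<longleftrightarrow> finite F \<and> (\<Sum>u\<in>F. (\<alpha> ^ length u) powr t) \<le> D * h n \<and>
        word_cover F {i \<in> A'. \<pi> i \<in> U n}" for n F
    have "\<exists>F. good n F" for n
    proof (cases "{i \<in> A'. \<pi> i \<in> U n} = {}")
      case True
      then have "good n {}" using D h_pos[of n] by (simp add: good_def)
      then show ?thesis ..
    next
      case False
      then obtain i0 where i0: "i0 \<in> A'" "\<pi> i0 \<in> U n" by blast
      \<comment> \<open>For exponent zero each non-empty covering set counts as one, more than the whole sum.\<close>
      have "t \<noteq> 0"
        using sum_d[of "{n}"] \<eta>(2) i0(2) by (auto simp: d_def split: if_splits)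
      then have "0 < t" using \<open>0 \<le> t\<close> by simp
      define \<rho> where "\<rho> = h n powr (1 / t)"
      have \<rho>: "0 < \<rho>" "\<rho> powr t = h n"
        using h_pos[of n] \<open>0 < t\<close> by (auto simp: \<rho>_def powr_powr)
      have diam_nonneg: "0 \<le> diameter (U n)" using U(2) by (rule diameter_ge_0)
      have "diameter (U n) = (diameter (U n) powr t) powr (1 / t)"
        using diam_nonneg \<open>0 < t\<close> by (simp add: powr_powr)
      also have "diameter (U n) powr t = d n" using i0 \<open>t \<noteq> 0\<close> by (auto simp: d_def)
      also have "d n powr (1 / t) \<le> \<rho>"
        unfolding \<rho>_def using d_nonneg[of n] \<eta>(1) \<open>0 < t\<close> by (intro powr_mono2) (auto simp: h_def)
      finally have diam: "diameter (U n) \<le> \<rho>" .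
      have "\<pi> i0 \<in> \<pi> ` \<Gamma>" using i0(1) A'(1) by blast
      from ball_word_cover[OF this \<rho>(1)]
      obtain F where F: "finite F" "card F \<le> M" "\<forall>u\<in>F. \<alpha> ^ length u \<le> C * \<rho>"
        "word_cover F {i \<in> \<Gamma>. dist (\<pi> i0) (\<pi> i) \<le> \<rho>}"
        by (elim exE conjE)
      have "(\<Sum>u\<in>F. (\<alpha> ^ length u) powr t) \<le> (\<Sum>u\<in>F. (C * \<rho>) powr t)"
        using F(3) \<alpha>_pos \<open>0 < t\<close> by (intro sum_mono powr_mono2) auto
      also have "\<dots> = real (card F) * (C powr t * h n)"
        using C_ge_1 \<rho> by (simp add: powr_mult)
      also have "\<dots> \<le> real M * (C powr t * h n)"
        using F(2) h_pos[of n] by (intro mult_right_mono) auto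
      finally have "(\<Sum>u\<in>F. (\<alpha> ^ length u) powr t) \<le> D * h n" by (simp add: D_def mult.assoc)
      moreover have near: "dist (\<pi> i0) (\<pi> i) \<le> \<rho>" if "\<pi> i \<in> U n" for i
        using diameter_bounded_bound[OF U(2) i0(2) that] diam by linarith
      have "word_cover F {i \<in> A'. \<pi> i \<in> U n}"
      proof
        fix i assume "i \<in> {i \<in> A'. \<pi> i \<in> U n}"
        then have "i \<in> {i \<in> \<Gamma>. dist (\<pi> i0) (\<pi> i) \<le> \<rho>}" using near A'(1) by auto
        then show "\<exists>u\<in>F. stake (length u) i = u" using F(4) by (rule bspec[rotated])
      qed
      ultimately have "good n F" using F(1) by (simp add: good_def)
      then show ?thesis ..
    qed
    then obtain F where "\<And>n. good n (F n)" by metis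
    then have F: "\<And>n. finite (F n)" "\<And>n. (\<Sum>u\<in>F n. (\<alpha> ^ length u) powr t) \<le> D * h n"
      "\<And>n. word_cover (F n) {i \<in> A'. \<pi> i \<in> U n}"
      unfolding good_def by blast+
    have "word_cover (\<Union>n. F n) A'"
    proof
      fix i assume "i \<in> A'"
      then obtain n where "\<pi> i \<in> U n" using U(1) by blast
      then obtain u where "u \<in> F n" "stake (length u) i = u" using F(3)[of n] \<open>i \<in> A'\<close> by auto
      then show "\<exists>u\<in>\<Union>n. F n. stake (length u) i = u" by blast
    qed
    from shift_compact_finite_cover[OF A'(2) this]
    obtain N where N: "finite N" "word_cover (\<Union>n\<in>N. F n) A'" by (elim exE conjE)
    have "(\<Sum>n\<in>N. (1/2::real) ^ Suc n) \<le> (\<Sum>n. (1/2) ^ Suc n)"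
      by (rule sum_le_suminf[OF sums_summable[OF power_half_series] N(1)]) (rule zero_le_power, simp)
    then have geometric: "(\<Sum>n\<in>N. (1/2::real) ^ Suc n) \<le> 1"
      unfolding sums_unique[OF power_half_series, symmetric] .
    have "finite (\<Union>n\<in>N. F n)" using N(1) F(1) by blast
    then have "1 \<le> (\<Sum>u\<in>(\<Union>n\<in>N. F n). (\<alpha> ^ length u) powr t)"
      using N(2) by (rule cover_sum_t)
    also have "\<dots> \<le> (\<Sum>n\<in>N. \<Sum>u\<in>F n. (\<alpha> ^ length u) powr t)"
      using N(1) F(1) by (rule sum_UN_le) simp
    also have "\<dots> \<le> (\<Sum>n\<in>N. D * h n)" by (intro sum_mono F(2))
    also have "\<dots> = D * ((\<Sum>n\<in>N. d n) + \<eta> * (\<Sum>n\<in>N. (1/2) ^ Suc n))"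
      by (simp only: h_def sum.distrib flip: sum_distrib_left)
    also have "\<dots> \<le> D * (\<eta> + \<eta> * 1)"
      using D \<eta>(1) less_imp_le[OF sum_d[OF N(1)]] geometric
      by (intro mult_left_mono add_mono) simp_all
    also have "\<dots> < 1" using \<eta>(3) by simp
    finally show False by simp
  qed
qed

text \<open>The images of the cylinders of length \<open>n\<close> cover the image of \<open>A'\<close>. Their number is at most a
  constant times \<open>\<alpha> ^ n\<close> to the power \<open>- t\<close>, so for exponents above \<open>t\<close> the sums of the
  powers of their diameters tend to zero.\<close>

lemma hausdorff_dim_image_le:
  assumes "A \<subseteq> \<Gamma>" "A' \<subseteq> \<Gamma>" and "0 \<le> t" and bound: "branching_bound \<alpha> A t"
    and trace: "\<And>n. \<exists>w. stake n ` A' \<subseteq> stake n ` tails w A"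
  shows "hausdorff_dim (\<pi> ` A') \<le> ennreal t"
proof (rule ennreal_le_epsilon)
  fix \<epsilon> :: real assume "0 < \<epsilon>"
  define s where "s = t + \<epsilon>"
  have s: "t < s" "0 < s" using \<open>0 < \<epsilon>\<close> \<open>0 \<le> t\<close> by (auto simp: s_def)
  obtain B where B: "\<And>w n. real (card (stake n ` tails w A)) \<le> B * (\<alpha> ^ n) powr (- t)"
    using bound unfolding branching_bound_def by blast
  have "0 \<le> B" using B[of 0 "[]"] by (simp add: order_trans[OF of_nat_0_le_iff])
  define b where "b n = B * C powr s * (\<alpha> ^ n) powr \<epsilon>" for n
  have premeasure: "hausdorff_premeasure s \<delta> (\<pi> ` A') \<le> ennreal (b n)"
    if "C * \<alpha> ^ n \<le> \<delta>" for \<delta> n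
  proof -
    define I where "I = stake n ` A'"
    define P where "P u = \<pi> ` {i \<in> A'. stake n i = u}" for u
    have fin: "finite I" unfolding I_def
      using \<open>A' \<subseteq> \<Gamma>\<close> \<Gamma>_shift_space by (intro finite_card_stake_image(1)[of _ \<kappa>]) blast
    obtain w where w: "I \<subseteq> stake n ` tails w A" using trace[of n] unfolding I_def by blast
    have "tails w A \<subseteq> shift_space \<kappa>"
      using \<open>A \<subseteq> \<Gamma>\<close> \<Gamma>_shift_space by (intro tails_subset_shift_space) blast
    then have "card I \<le> card (stake n ` tails w A)"
      using w by (intro card_mono finite_card_stake_image(1))
    then have card: "real (card I) \<le> B * (\<alpha> ^ n) powr (- t)" using B[of n w] by linarith
    have pos: "0 \<le> C * \<alpha> ^ n" using C_ge_1 \<alpha>_pos by simp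
    have P: "bounded (P u)" "diameter (P u) \<le> C * \<alpha> ^ n" for u
      using \<open>A' \<subseteq> \<Gamma>\<close> pos by (auto simp: P_def intro!: diameter_le_of_dist_le dist_coding)
    have "hausdorff_premeasure s \<delta> (\<pi> ` A') \<le> (\<Sum>u\<in>I. diam_power s (P u))"
      using pos that P fin by (intro hausdorff_premeasure_le_finite_cover) (auto simp: I_def P_def intro: order_trans)
    also have "\<dots> \<le> (\<Sum>u\<in>I. ennreal ((C * \<alpha> ^ n) powr s))"
      using P s by (intro sum_mono) (auto simp: diam_power_def intro!: ennreal_leI powr_mono2 diameter_ge_0)
    also have "\<dots> = ennreal (real (card I) * (C * \<alpha> ^ n) powr s)"
      by (simp add: ennreal_mult ennreal_of_nat_eq_real_of_nat)
    also have "\<dots> \<le> ennreal (B * (\<alpha> ^ n) powr (- t) * (C * \<alpha> ^ n) powr s)"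
      using card by (intro ennreal_leI mult_right_mono) auto
    also have "B * (\<alpha> ^ n) powr (- t) * (C * \<alpha> ^ n) powr s = b n"
      using C_ge_1 \<alpha>_pos by (simp add: b_def s_def powr_mult powr_add powr_minus field_simps)
    finally show ?thesis .
  qed
  have lim0: "(\<lambda>n. \<alpha> ^ n) \<longlonglongrightarrow> 0" using \<alpha>_pos \<alpha>_less_1 by (intro LIMSEQ_power_zero) auto
  have b_lim: "(\<lambda>n. ennreal (b n)) \<longlonglongrightarrow> 0"
  proof -
    have "(\<lambda>n. (\<alpha> ^ n) powr \<epsilon>) \<longlonglongrightarrow> 0 powr \<epsilon>"
      using lim0 \<alpha>_pos \<open>0 < \<epsilon>\<close> by (intro tendsto_powr2 tendsto_const) auto
    then have "b \<longlonglongrightarrow> 0" unfolding b_def by (intro tendsto_mult_right_zero) simp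
    then show ?thesis using tendsto_ennrealI by fastforce
  qed
  have "hausdorff_premeasure s \<delta> (\<pi> ` A') \<le> 0" if "0 < \<delta>" for \<delta>
  proof (rule tendsto_lowerbound[OF b_lim])
    have "(\<lambda>n. C * \<alpha> ^ n) \<longlonglongrightarrow> 0" by (intro tendsto_mult_right_zero lim0)
    then have "\<forall>\<^sub>F n in sequentially. C * \<alpha> ^ n < \<delta>" using that by (rule order_tendstoD)
    then show "\<forall>\<^sub>F n in sequentially. hausdorff_premeasure s \<delta> (\<pi> ` A') \<le> ennreal (b n)"
      by eventually_elim (rule premeasure, simp)
  qed simp
  then have "hausdorff_measure s (\<pi> ` A') = 0" by (auto simp: hausdorff_measure_def)
  then have "hausdorff_dim (\<pi> ` A') \<le> ennreal s"
    unfolding hausdorff_dim_def using s by (intro Inf_lower) auto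
  then show "hausdorff_dim (\<pi> ` A') \<le> ennreal t + ennreal \<epsilon>"
    using \<open>0 \<le> t\<close> \<open>0 < \<epsilon>\<close> by (simp add: s_def)
qed

end

text \<open>The infimum of the non-negative such \<open>t\<close> is the Assouad dimension.\<close>

definition assouad_exponent :: "'a::metric_space set \<Rightarrow> real \<Rightarrow> bool" where
  "assouad_exponent S t \<longleftrightarrow> (\<exists>K\<ge>1. \<forall>x\<in>S. \<forall>r R. 0 < r \<and> r < R \<longrightarrow>
     (\<exists>F. finite F \<and> F \<subseteq> S \<and> real (card F) \<le> K * (r / R) powr (- t) \<and>
          S \<inter> cball x R \<subseteq> (\<Union>y\<in>F. cball y r)))"

context symbolic_coding
begin

text \<open>The miniset at \<open>w\<close> is coded into a ball of radius \<open>R\<close> comparable to \<open>\<alpha> ^ length w\<close>. Cover it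
  by balls of radius \<open>r\<close> comparable to \<open>\<alpha> ^ (length w + n)\<close>; each of them meets the images
  of at most \<open>M\<close> cylinders of that length.\<close>

lemma branching_bound_of_assouad_exponent:
  assumes "A \<subseteq> \<Gamma>" and "assouad_exponent (\<pi> ` A) t"
  shows "branching_bound \<alpha> A t"
proof -
  obtain K where K: "1 \<le> K"
    and K_cover: "\<forall>x\<in>\<pi> ` A. \<forall>r R. 0 < r \<and> r < R \<longrightarrow>
      (\<exists>F. finite F \<and> F \<subseteq> \<pi> ` A \<and> real (card F) \<le> K * (r / R) powr (- t) \<and>
          \<pi> ` A \<inter> cball x R \<subseteq> (\<Union>y\<in>F. cball y r))"
    using assms(2) unfolding assouad_exponent_def by (elim exE conjE)
  have cover: "\<exists>F. finite F \<and> F \<subseteq> \<pi> ` A \<and> real (card F) \<le> K * (r / R) powr (- t) \<and>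
          \<pi> ` A \<inter> cball x R \<subseteq> (\<Union>y\<in>F. cball y r)"
    if "x \<in> \<pi> ` A" "0 < r" "r < R" for x r R
    using bspec[OF K_cover that(1)] that(2,3) by simp
  define c where "c = \<alpha> / C\<^sup>2"
  have "0 < c" using \<alpha>_pos C_ge_1 by (simp add: c_def)
  have "real (card (stake n ` tails w A)) \<le> (real M * K * c powr (- t)) * (\<alpha> ^ n) powr (- t)" for w n
  proof (cases "tails w A = {}")
    case True
    then show ?thesis using K by simp
  next
    case False
    then obtain j0 where "w @- j0 \<in> A" by (auto simp: tails_def)
    define x where "x = \<pi> (w @- j0)"
    have x: "x \<in> \<pi> ` A" using \<open>w @- j0 \<in> A\<close> by (simp add: x_def)
    define R where "R = C * \<alpha> ^ length w"
    \<comment> \<open>So small that the words covering the preimage of a ball of radius \<open>r\<close> are longer than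
      \<open>length w + n\<close>; the extra factor \<open>\<alpha>\<close> gives \<open>r < R\<close> also when \<open>C = 1\<close> and \<open>n = 0\<close>.\<close>
    define r where "r = \<alpha> ^ Suc (length w + n) / C"
    have "0 < r" using \<alpha>_pos C_ge_1 by (simp add: r_def)
    have ratio: "r / R = c * \<alpha> ^ n"
      using \<alpha>_pos C_ge_1 by (simp add: r_def R_def c_def power_add power2_eq_square)
    have "c * \<alpha> ^ n < 1 * 1"
    proof (rule mult_less_le_imp_less)
      have "1 \<le> C\<^sup>2" using C_ge_1 by (rule one_le_power)
      then show "c < 1" using \<alpha>_less_1 by (simp add: c_def divide_less_eq)
      show "\<alpha> ^ n \<le> 1" using length_power_mono[of 0 n] by simp
    qed (use \<open>0 < c\<close> \<alpha>_pos in auto)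
    moreover have "0 < R" using \<alpha>_pos C_ge_1 by (simp add: R_def)
    ultimately have "r < R" using divide_less_eq_1_pos[of R r] unfolding ratio by simp
    from cover[OF x \<open>0 < r\<close> this] obtain F where F: "finite F" "F \<subseteq> \<pi> ` A"
      "real (card F) \<le> K * (r / R) powr (- t)" "\<pi> ` A \<inter> cball x R \<subseteq> (\<Union>y\<in>F. cball y r)"
      by (elim exE conjE)
    define good where "good y G \<longleftrightarrow> finite G \<and> card G \<le> M \<and> (\<forall>u\<in>G. \<alpha> ^ length u \<le> C * r) \<and>
        word_cover G {i \<in> \<Gamma>. dist y (\<pi> i) \<le> r}" for y G
    have "\<exists>G. good y G" if "y \<in> F" for y
      unfolding good_def using that F(2) \<open>A \<subseteq> \<Gamma>\<close> \<open>0 < r\<close> by (intro ball_word_cover) auto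
    then obtain G where "\<And>y. y \<in> F \<Longrightarrow> good y (G y)" by metis
    then have G: "\<And>y. y \<in> F \<Longrightarrow> finite (G y)" "\<And>y. y \<in> F \<Longrightarrow> card (G y) \<le> M"
      "\<And>y u. y \<in> F \<Longrightarrow> u \<in> G y \<Longrightarrow> \<alpha> ^ length u \<le> C * r"
      "\<And>y. y \<in> F \<Longrightarrow> word_cover (G y) {i \<in> \<Gamma>. dist y (\<pi> i) \<le> r}"
      unfolding good_def by blast+
    have "stake n ` tails w A \<subseteq> (\<Union>y\<in>F. (\<lambda>u. take n (drop (length w) u)) ` G y)"
    proof clarify
      fix j assume "j \<in> tails w A"
      define i where "i = w @- j"
      have i: "i \<in> A" "i \<in> \<Gamma>" using \<open>j \<in> tails w A\<close> \<open>A \<subseteq> \<Gamma>\<close> by (auto simp: i_def tails_def)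
      have "dist x (\<pi> i) \<le> R"
        unfolding x_def R_def using \<open>w @- j0 \<in> A\<close> i(2) \<open>A \<subseteq> \<Gamma>\<close>
        by (intro dist_coding) (auto simp: i_def stake_shift)
      then have "\<pi> i \<in> \<pi> ` A \<inter> cball x R" using i(1) by simp
      then obtain y where y: "y \<in> F" "dist y (\<pi> i) \<le> r" using F(4) by auto
      then obtain u where u: "u \<in> G y" "stake (length u) i = u" using G(4)[OF y(1)] i(2) by auto
      have "\<alpha> ^ length u \<le> \<alpha> ^ Suc (length w + n)"
        using G(3)[OF y(1) u(1)] C_ge_1 by (simp add: r_def)
      then have "length w + n \<le> length u" by (simp add: length_power_le_iff del: power_Suc)
      then have "min n (length u - length w) = n" by simp
      then have "stake n j = take n (drop (length w) u)"
        using arg_cong[OF u(2), of "\<lambda>v. take n (drop (length w) v)"]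
        by (simp add: drop_stake take_stake i_def sdrop_shift)
      then show "stake n j \<in> (\<Union>y\<in>F. (\<lambda>u. take n (drop (length w) u)) ` G y)"
        by (intro UN_I[OF y(1)] image_eqI[OF _ u(1)])
    qed
    then have "card (stake n ` tails w A) \<le> card (\<Union>y\<in>F. (\<lambda>u. take n (drop (length w) u)) ` G y)"
      using F(1) G(1) by (intro card_mono finite_UN_I finite_imageI)
    also have "\<dots> \<le> (\<Sum>y\<in>F. card ((\<lambda>u. take n (drop (length w) u)) ` G y))"
      by (rule card_UN_le[OF F(1)])
    also have "\<dots> \<le> (\<Sum>y\<in>F. M)"
      by (intro sum_mono order_trans[OF card_image_le G(2)] G(1))
    finally have "real (card (stake n ` tails w A)) \<le> real (M * card F)"
      by (intro of_nat_mono) (simp add: mult.commute)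
    also have "\<dots> \<le> real M * (K * (r / R) powr (- t))"
      using F(3) by (simp add: mult_left_mono)
    also have "(r / R) powr (- t) = c powr (- t) * (\<alpha> ^ n) powr (- t)"
      unfolding ratio using \<open>0 < c\<close> \<alpha>_pos by (simp add: powr_mult)
    finally show ?thesis by (simp add: mult.assoc)
  qed
  then show ?thesis unfolding branching_bound_def by blast
qed

text \<open>The preimage of a ball of radius \<open>R\<close> is covered by \<open>M\<close> cylinders of at most comparable size.
  Each of them is subdivided into cylinders of length \<open>p\<close>, whose images have diameter at
  most \<open>r\<close>; one point is taken from each.\<close>

lemma assouad_exponent_of_branching_bound:
  assumes "A \<subseteq> \<Gamma>" and "0 \<le> t" and "branching_bound \<alpha> A t"
  shows "assouad_exponent (\<pi> ` A) t"
proof -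
  obtain B where B: "\<And>w n. real (card (stake n ` tails w A)) \<le> B * (\<alpha> ^ n) powr (- t)"
    using assms(3) unfolding branching_bound_def by blast
  have "0 \<le> B" using B[of 0 "[]"] by (simp add: order_trans[OF of_nat_0_le_iff])
  define c where "c = \<alpha> / C\<^sup>2"
  have c: "0 < c" using \<alpha>_pos C_ge_1 by (simp add: c_def)
  define K where "K = max 1 (real M * B * c powr (- t))"
  have fin: "finite (stake m ` tails w A)" for m w
    using tails_subset_shift_space \<open>A \<subseteq> \<Gamma>\<close> \<Gamma>_shift_space finite_card_stake_image(1) by (metis order_trans)
  have main: "\<exists>F. finite F \<and> F \<subseteq> \<pi> ` A \<and> real (card F) \<le> K * (r / R) powr (- t) \<and>
      \<pi> ` A \<inter> cball x R \<subseteq> (\<Union>y\<in>F. cball y r)"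
    if x: "x \<in> \<pi> ` A" and r: "0 < r" "r < R" for x r R
  proof -
    have "0 < R" using r by simp
    have "x \<in> \<pi> ` \<Gamma>" using x \<open>A \<subseteq> \<Gamma>\<close> by blast
    from ball_word_cover[OF this \<open>0 < R\<close>]
    obtain G where G: "finite G" "card G \<le> M" "\<forall>u\<in>G. \<alpha> ^ length u \<le> C * R"
      "word_cover G {i \<in> \<Gamma>. dist x (\<pi> i) \<le> R}"
      by (elim exE conjE)
    define p where "p = (LEAST p. C * \<alpha> ^ p \<le> r)"
    have "\<exists>p. C * \<alpha> ^ p \<le> r"
    proof -
      obtain p where "\<alpha> ^ p < r / C"
        using real_arch_pow_inv[of "r / C" \<alpha>] \<alpha>_less_1 r C_ge_1 by auto
      then have "C * \<alpha> ^ p \<le> r" using C_ge_1 by (simp add: pos_less_divide_eq mult.commute)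
      then show ?thesis ..
    qed
    then have p: "C * \<alpha> ^ p \<le> r" unfolding p_def by (rule LeastI_ex)
    have p_least: "r < C * \<alpha> ^ q" if "q < p" for q
      using not_less_Least that unfolding p_def by (metis not_le)
    define pt where "pt u v = \<pi> (u @- (SOME j. j \<in> tails u A \<and> stake (p - length u) j = v))" for u v
    \<comment> \<open>For words \<open>u\<close> longer than \<open>p\<close> the truncated difference is zero, and \<open>u\<close> is not subdivided.\<close>
    define V where "V u = stake (p - length u) ` tails u A" for u
    define F where "F = (\<Union>u\<in>G. pt u ` V u)"
    have some: "(SOME j. j \<in> tails u A \<and> stake (p - length u) j = v) \<in> tails u A \<and>
        stake (p - length u) (SOME j. j \<in> tails u A \<and> stake (p - length u) j = v) = v"
      if "v \<in> V u" for u v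
      by (rule someI_ex) (use that in \<open>auto simp: V_def\<close>)
    have "finite F" using G(1) fin by (auto simp: F_def V_def)
    moreover have "F \<subseteq> \<pi> ` A" using some by (auto simp: F_def pt_def tails_def)
    moreover have "real (card F) \<le> K * (r / R) powr (- t)"
    proof -
      have V: "real (card (V u)) \<le> B * (c * (r / R)) powr (- t)" if "u \<in> G" for u
      proof -
        have "c * (r / R) \<le> \<alpha> ^ (p - length u)"
        proof (cases "p \<le> length u")
          case True
          have "1 \<le> C\<^sup>2" using C_ge_1 by (rule one_le_power)
          then have "c \<le> 1" using \<alpha>_less_1 by (simp add: c_def divide_le_eq)
          moreover have "r / R \<le> 1" using r by (simp add: divide_le_eq)
          ultimately have "c * (r / R) \<le> 1" using c r by (intro mult_le_one) auto
          moreover have "p - length u = 0" using True by simp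
          ultimately show ?thesis by (simp only: power_0)
        next
          case False
          then have "r \<le> C * \<alpha> ^ (p - 1)" using p_least[of "p - 1"] by simp
          then have "\<alpha> * r \<le> C * \<alpha> ^ p"
            using False \<alpha>_pos by (simp add: power_eq_if[of \<alpha> p] mult.left_commute)
          also have "\<alpha> ^ p = \<alpha> ^ (p - length u) * \<alpha> ^ length u"
            using False by (simp flip: power_add)
          also have "C * \<dots> \<le> C * (\<alpha> ^ (p - length u) * (C * R))"
            using G(3) that C_ge_1 \<alpha>_pos by (intro mult_left_mono) auto
          finally show ?thesis
            using C_ge_1 \<open>0 < R\<close> by (simp add: c_def divide_le_eq power2_eq_square mult_ac)
        qed
        then have "(\<alpha> ^ (p - length u)) powr (- t) \<le> (c * (r / R)) powr (- t)"
          using c r \<open>0 \<le> t\<close> by (intro powr_mono2') auto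
        then have "B * (\<alpha> ^ (p - length u)) powr (- t) \<le> B * (c * (r / R)) powr (- t)"
          using \<open>0 \<le> B\<close> by (rule mult_left_mono)
        with B[of "p - length u" u] show ?thesis unfolding V_def by linarith
      qed
      have "card F \<le> (\<Sum>u\<in>G. card (pt u ` V u))" unfolding F_def by (rule card_UN_le[OF G(1)])
      also have "\<dots> \<le> (\<Sum>u\<in>G. card (V u))" using fin by (intro sum_mono card_image_le) (simp add: V_def)
      finally have "real (card F) \<le> (\<Sum>u\<in>G. real (card (V u)))"
        unfolding of_nat_sum[symmetric] by (rule of_nat_mono)
      also have "\<dots> \<le> (\<Sum>u\<in>G. B * (c * (r / R)) powr (- t))" by (intro sum_mono V)
      also have "\<dots> = real (card G) * (B * (c * (r / R)) powr (- t))" by simp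
      also have "\<dots> \<le> real M * (B * (c * (r / R)) powr (- t))"
        using G(2) \<open>0 \<le> B\<close> by (intro mult_right_mono) auto
      also have "(c * (r / R)) powr (- t) = c powr (- t) * (r / R) powr (- t)"
        using c r by (intro powr_mult)
      also have "real M * (B * (c powr (- t) * (r / R) powr (- t)))
          = (real M * B * c powr (- t)) * (r / R) powr (- t)" by (simp only: mult.assoc)
      also have "\<dots> \<le> K * (r / R) powr (- t)" by (intro mult_right_mono) (auto simp: K_def)
      finally show ?thesis .
    qed
    moreover have "\<pi> ` A \<inter> cball x R \<subseteq> (\<Union>y\<in>F. cball y r)"
    proof clarify
      fix i assume "i \<in> A" "\<pi> i \<in> cball x R"
      then have "i \<in> {i \<in> \<Gamma>. dist x (\<pi> i) \<le> R}" using \<open>A \<subseteq> \<Gamma>\<close> by auto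
      from bspec[OF G(4) this] obtain u where u: "u \<in> G" "stake (length u) i = u" by (elim bexE)
      define j where "j = sdrop (length u) i"
      have i: "i = u @- j" using u(2) unfolding j_def by (metis stake_sdrop)
      then have "j \<in> tails u A" using \<open>i \<in> A\<close> by (simp add: tails_def)
      define v where "v = stake (p - length u) j"
      have v: "v \<in> V u" using \<open>j \<in> tails u A\<close> by (simp add: v_def V_def)
      define j' where "j' = (SOME j. j \<in> tails u A \<and> stake (p - length u) j = v)"
      have j': "j' \<in> tails u A" "stake (p - length u) j' = stake (p - length u) j"
        using some[OF v] unfolding j'_def v_def by blast+
      have "dist (\<pi> (u @- j')) (\<pi> i) \<le> C * \<alpha> ^ p"
        using j' \<open>i \<in> A\<close> \<open>A \<subseteq> \<Gamma>\<close> by (intro dist_coding) (auto simp: i tails_def stake_shift)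
      then have "\<pi> i \<in> cball (pt u v) r" using p by (simp add: pt_def j'_def)
      then show "\<pi> i \<in> (\<Union>y\<in>F. cball y r)" using u(1) v by (auto simp: F_def)
    qed
    ultimately show ?thesis by blast
  qed
  have "1 \<le> K" by (simp add: K_def)
  then show ?thesis
    unfolding assouad_exponent_def by (intro exI[of _ K] conjI ballI allI impI main) simp_all
qed

end

context symbolic_coding
begin

text \<open>Both dimensions are compared with the infimum of the branching exponents. Any \<open>s\<close> below this
  infimum violates the branching bound, and so the projection of a single microset has
  Hausdorff dimension at least \<open>s\<close>.\<close>

theorem assouad_dim_image_eq_SUP_hausdorff_dim:
  assumes "A \<subseteq> \<Gamma>"
  shows "assouad_dim (\<pi> ` A) = (SUP A'\<in>{A'. microset \<kappa> \<Gamma> A A'}. hausdorff_dim (\<pi> ` A'))"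
    (is "_ = ?S")
proof -
  have "assouad_dim (\<pi> ` A) = Inf {ennreal t |t. 0 \<le> t \<and> assouad_exponent (\<pi> ` A) t}"
    by (simp only: assouad_dim_def assouad_exponent_def)
  also have "{ennreal t |t. 0 \<le> t \<and> assouad_exponent (\<pi> ` A) t} =
      {ennreal t |t. 0 \<le> t \<and> branching_bound \<alpha> A t}"
    using branching_bound_of_assouad_exponent[OF assms] assouad_exponent_of_branching_bound[OF assms]
    by blast
  finally have dim: "assouad_dim (\<pi> ` A) = Inf {ennreal t |t. 0 \<le> t \<and> branching_bound \<alpha> A t}"
    (is "_ = ?I") .
  have A: "A \<subseteq> shift_space \<kappa>" using assms \<Gamma>_shift_space by blast
  have "?S \<le> ?I"
  proof (rule SUP_least, rule Inf_greatest)
    fix A' and a assume "A' \<in> {A'. microset \<kappa> \<Gamma> A A'}"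
      and "a \<in> {ennreal t |t. 0 \<le> t \<and> branching_bound \<alpha> A t}"
    then obtain t w where t: "a = ennreal t" "0 \<le> t" "branching_bound \<alpha> A t" and "A' \<subseteq> \<Gamma>"
      and lim: "(\<lambda>n. hausdorff_dist shift_dist (miniset \<kappa> (w n) A) A') \<longlonglongrightarrow> 0"
      unfolding microset_def by blast
    have trace: "\<exists>w. stake n ` A' \<subseteq> stake n ` tails w A" for n
    proof -
      have "\<forall>\<^sub>F k in sequentially. hausdorff_dist shift_dist (miniset \<kappa> (w k) A) A' < ennreal ((1/2) ^ n)"
        by (rule order_tendstoD(2)[OF lim]) simp
      from eventually_happens'[OF sequentially_bot this]
      obtain k where "hausdorff_dist shift_dist (tails (w k) A) A' < ennreal ((1/2) ^ n)"
        unfolding miniset_eq_tails[OF A] by (elim exE)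
      from stake_image_subset_of_hausdorff_dist[OF this] show ?thesis by (rule exI)
    qed
    show "hausdorff_dim (\<pi> ` A') \<le> a"
      unfolding t(1) by (rule hausdorff_dim_image_le[OF assms \<open>A' \<subseteq> \<Gamma>\<close> t(2,3) trace])
  qed
  moreover have "?I \<le> ?S"
  proof (rule ccontr)
    assume "\<not> ?thesis"
    then have "?S < ?I" by (rule not_le_imp_less)
    from dense[OF this] obtain z where z: "?S < z" "z < ?I" by (elim exE conjE)
    have "z < top" using z(2) top_greatest by (rule less_le_trans)
    then obtain s where s: "z = ennreal s" "0 \<le> s" by (cases z) auto
    have "\<not> branching_bound \<alpha> A s"
    proof
      assume "branching_bound \<alpha> A s"
      then have "?I \<le> ennreal s" using s(2) by (intro Inf_lower) auto
      then show False using z(2) s(1) by simp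
    qed
    from exists_microset_word_cover_sum_ge_1[OF compact_\<Gamma> shift_\<Gamma> assms \<alpha>_pos \<alpha>_less_1 s(2) this]
    obtain A' where A': "microset \<kappa> \<Gamma> A A'"
      and sums: "\<forall>G. finite G \<and> word_cover G A' \<longrightarrow> 1 \<le> (\<Sum>u\<in>G. (\<alpha> ^ length u) powr s)"
      by (elim exE conjE)
    have "ennreal s \<le> hausdorff_dim (\<pi> ` A')"
      using A' sums unfolding microset_def by (intro hausdorff_dim_image_ge) simp_all
    also have "\<dots> \<le> ?S" using A' by (intro SUP_upper) simp
    finally show False using z(1) s(1) by simp
  qed
  ultimately show ?thesis unfolding dim by (rule antisym[rotated])
qed

end

section \<open>Moran constructions as coded sets\<close>

lemma word_map_Cons: "word_map \<phi> (a # w) = \<phi> a \<circ> word_map \<phi> w"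
  by (simp add: word_map_def)

lemma word_map_append: "word_map \<phi> (u @ v) = word_map \<phi> u \<circ> word_map \<phi> v"
proof (induction u)
  case (Cons a u)
  then show ?case by (simp add: word_map_Cons comp_assoc)
qed (simp add: word_map_def)

lemma word_map_image_subset:
  "(\<And>a. a \<in> S \<Longrightarrow> \<phi> a ` W \<subseteq> W) \<Longrightarrow> set w \<subseteq> S \<Longrightarrow> word_map \<phi> w ` W \<subseteq> W"
proof (induction w)
  case (Cons a w)
  then have "word_map \<phi> w ` W \<subseteq> W" "\<phi> a ` W \<subseteq> W" by auto
  then show ?case unfolding word_map_Cons image_comp[symmetric] by blast
qed (simp add: word_map_def)

lemma continuous_on_word_map:
  assumes "\<And>a. a \<in> S \<Longrightarrow> continuous_on W (\<phi> a)" "\<And>a. a \<in> S \<Longrightarrow> \<phi> a ` W \<subseteq> W" "set w \<subseteq> S"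
  shows "continuous_on W (word_map \<phi> w)"
  using assms(3)
proof (induction w)
  case Nil
  show ?case by (simp add: word_map_def id_def)
next
  case (Cons a w)
  have "word_map \<phi> w ` W \<subseteq> W"
    using assms(2) Cons.prems by (intro word_map_image_subset[of S]) auto
  then have "continuous_on (word_map \<phi> w ` W) (\<phi> a)"
    using assms(1)[of a] Cons.prems by (auto intro: continuous_on_subset)
  then show ?case using Cons unfolding word_map_Cons by (intro continuous_on_compose) auto
qed

lemma set_stake_subset: "i \<in> shift_space \<kappa> \<Longrightarrow> set (stake n i) \<subseteq> {1..\<kappa>}"
  by (fastforce simp: shift_space_def streams_iff_sset sset_range in_set_conv_nth)

lemma moran_set_stake_antimono:
  assumes "\<And>a. a \<in> {1..\<kappa>} \<Longrightarrow> \<phi> a ` W \<subseteq> W" and "i \<in> shift_space \<kappa>" and "m \<le> n"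
  shows "moran_set \<phi> W (stake n i) \<subseteq> moran_set \<phi> W (stake m i)"
proof -
  have eq: "stake n i = stake m i @ stake (n - m) (sdrop m i)" using \<open>m \<le> n\<close> by simp
  have "set (stake (n - m) (sdrop m i)) \<subseteq> set (stake n i)" unfolding eq set_append by (rule Un_upper2)
  then have "word_map \<phi> (stake (n - m) (sdrop m i)) ` W \<subseteq> W"
    using assms(1) set_stake_subset[OF assms(2), of n] by (intro word_map_image_subset[of "{1..\<kappa>}"]) auto
  then show ?thesis
    unfolding moran_set_def eq word_map_append image_comp[symmetric] by (rule image_mono)
qed

text \<open>The sets along a word are compact, nested and shrink to a point, so that the definite
  description in the projection denotes that point.\<close>

lemma moran_proj_mem:
  fixes W :: "'a::complete_space set"
  assumes W: "compact W" "W \<noteq> {}"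
    and \<phi>: "\<And>a. a \<in> {1..\<kappa>} \<Longrightarrow> continuous_on W (\<phi> a)" "\<And>a. a \<in> {1..\<kappa>} \<Longrightarrow> \<phi> a ` W \<subseteq> W"
    and i: "i \<in> shift_space \<kappa>" and small: "(\<lambda>n. diameter (moran_set \<phi> W (stake n i))) \<longlonglongrightarrow> 0"
  shows "moran_proj \<phi> W i \<in> moran_set \<phi> W (stake n i)"
proof -
  let ?E = "\<lambda>n. moran_set \<phi> W (stake (Suc n) i)"
  have comp: "compact (?E n)" for n
    unfolding moran_set_def
    by (rule compact_continuous_image[OF continuous_on_word_map[OF \<phi> set_stake_subset[OF i]] W(1)])
  have "\<exists>n. \<forall>x\<in>?E n. \<forall>y\<in>?E n. dist x y < e" if "0 < e" for e
  proof -
    have "\<forall>\<^sub>F n in sequentially. diameter (?E n) < e"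
      by (rule order_tendstoD(2)[OF LIMSEQ_Suc[OF small] that])
    from eventually_happens'[OF sequentially_bot this] obtain n where "diameter (?E n) < e" by (elim exE)
    then have "dist x y < e" if "x \<in> ?E n" "y \<in> ?E n" for x y
      using diameter_bounded_bound[OF compact_imp_bounded[OF comp] that] by linarith
    then show ?thesis by (intro exI[of _ n] ballI)
  qed
  then have "\<exists>a. \<Inter>(range ?E) = {a}"
    using comp W(2) moran_set_stake_antimono[OF \<phi>(2) i]
    by (intro decreasing_closed_nest_sing compact_imp_closed) (auto simp: moran_set_def simp del: stake.simps)
  then obtain a where a: "\<Inter>(range ?E) = {a}" ..
  have "{1..} = range Suc" by (auto simp: image_iff) (metis Suc_le_D)
  then have "(\<Inter>n\<in>{1..}. moran_set \<phi> W (stake n i)) = {a}"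
    using a by (simp only: image_image)
  then have "moran_proj \<phi> W i = a" unfolding moran_proj_def by simp
  then have "moran_proj \<phi> W i \<in> ?E n" using a by blast
  moreover have "?E n \<subseteq> moran_set \<phi> W (stake n i)"
    by (rule moran_set_stake_antimono[OF \<phi>(2) i]) simp_all
  ultimately show ?thesis by (rule rev_subsetD)
qed

text \<open>The words that clustering controls are the stopping words at scale \<open>r\<close>. Each word of \<open>\<Gamma>\<close> has
  an initial stopping word as soon as \<open>r\<close> is less than the diameter of \<open>W\<close>; otherwise there
  are none, but then the empty word is short enough to serve.\<close>

lemma clustering_word_cover:
  assumes \<Gamma>: "\<Gamma> \<subseteq> shift_space \<kappa>" and "1 \<le> C" "0 < \<alpha>" "\<alpha> < 1"
    and diam: "\<And>w. w \<in> initial_words \<Gamma> \<Longrightarrow> inverse C * \<alpha> ^ length w \<le> diameter (moran_set \<phi> W w) \<and>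
      diameter (moran_set \<phi> W w) \<le> C * \<alpha> ^ length w"
    and mem: "\<And>i n. i \<in> \<Gamma> \<Longrightarrow> moran_proj \<phi> W i \<in> moran_set \<phi> W (stake n i)"
    and finite_clustering: "finite (stopping_words_near \<Gamma> \<phi> W x r)"
      "card (stopping_words_near \<Gamma> \<phi> W x r) \<le> M"
    and x: "x \<in> moran_proj \<phi> W ` \<Gamma>" and "0 < r"
  shows "\<exists>F. finite F \<and> card F \<le> max 1 M \<and> (\<forall>u\<in>F. \<alpha> ^ length u \<le> C * r) \<and>
    word_cover F {i \<in> \<Gamma>. dist x (moran_proj \<phi> W i) \<le> r}"
proof -
  have stake_word: "stake n i \<in> initial_words \<Gamma>" if "i \<in> \<Gamma>" for n i
    using that by (auto simp: initial_words_def)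
  have length_le: "\<alpha> ^ length w \<le> C * r" if "w \<in> initial_words \<Gamma>" "diameter (moran_set \<phi> W w) \<le> r" for w
  proof -
    have "inverse C * \<alpha> ^ length w \<le> r" using diam[OF that(1)] that(2) by linarith
    then show ?thesis using \<open>1 \<le> C\<close> by (simp add: field_simps)
  qed
  show ?thesis
  proof (cases "diameter W \<le> r")
    case True
    have "[] \<in> initial_words \<Gamma>" using x stake_word[of _ 0] by auto
    moreover have "moran_set \<phi> W [] = W" by (simp add: moran_set_def word_map_def)
    ultimately have "\<alpha> ^ length ([] :: nat list) \<le> C * r" using True by (intro length_le) auto
    then show ?thesis by (intro exI[of _ "{[]}"]) simp
  next
    case False
    have "word_cover (stopping_words_near \<Gamma> \<phi> W x r) {i \<in> \<Gamma>. dist x (moran_proj \<phi> W i) \<le> r}"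
    proof
      fix i assume "i \<in> {i \<in> \<Gamma>. dist x (moran_proj \<phi> W i) \<le> r}"
      then have i: "i \<in> \<Gamma>" "dist x (moran_proj \<phi> W i) \<le> r" by auto
      let ?d = "\<lambda>n. diameter (moran_set \<phi> W (stake n i))"
      define n where "n = (LEAST n. ?d n \<le> r)"
      obtain n0 where "\<alpha> ^ n0 < r / C"
        using real_arch_pow_inv[of "r / C" \<alpha>] assms by auto
      then have "C * \<alpha> ^ n0 \<le> r" using \<open>1 \<le> C\<close> by (simp add: field_simps)
      moreover have "?d n0 \<le> C * \<alpha> ^ n0" using diam[OF stake_word[OF i(1), of n0]] by simp
      ultimately have "\<exists>n. ?d n \<le> r" by (intro exI[of _ n0]) linarith
      then have n: "?d n \<le> r" unfolding n_def by (rule LeastI_ex)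
      moreover have "?d 0 = diameter W" by (simp add: moran_set_def word_map_def)
      ultimately have "n \<noteq> 0" using False by (intro notI) simp
      have "\<not> ?d (n - 1) \<le> r"
        unfolding n_def by (rule not_less_Least) (use \<open>n \<noteq> 0\<close> in \<open>simp add: n_def\<close>)
      moreover have "butlast (stake n i) = stake (n - 1) i"
        by (simp add: butlast_conv_take take_stake min_def)
      ultimately have "stake n i \<in> stopping_words \<Gamma> \<phi> W r"
        using n stake_word[OF i(1)] \<open>n \<noteq> 0\<close> by (simp add: stopping_words_def)
      then have "stake n i \<in> stopping_words_near \<Gamma> \<phi> W x r"
        using mem[OF i(1), of n] i(2) by (auto simp: stopping_words_near_def)
      then show "\<exists>u\<in>stopping_words_near \<Gamma> \<phi> W x r. stake (length u) i = u"
        by (rule bexI[rotated]) simp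
    qed
    moreover have "\<forall>u\<in>stopping_words_near \<Gamma> \<phi> W x r. \<alpha> ^ length u \<le> C * r"
      using length_le by (auto simp: stopping_words_near_def stopping_words_def)
    ultimately show ?thesis using finite_clustering by (meson max.coboundedI2)
  qed
qed

theorem corollary5p2:
  fixes \<kappa> :: nat
    and X W :: "(real ^ 'd) set"
    and \<phi> :: "nat \<Rightarrow> real ^ 'd \<Rightarrow> real ^ 'd"
    and \<Gamma> A :: "nat stream set"
    and C \<alpha> :: real
  assumes "\<kappa> \<ge> 2"
    and "conformal_ifs \<kappa> X \<phi>"
    and "\<Gamma> \<subseteq> shift_space \<kappa>" and "shift_compact \<kappa> \<Gamma>" and "stl ` \<Gamma> \<subseteq> \<Gamma>"
    and "W \<subseteq> X" and "closed W" and "bounded W" and "diameter W > 0"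
    and "\<forall>i\<in>{1..\<kappa>}. \<phi> i ` W \<subseteq> W"
    and "uniform_finite_clustering \<Gamma> \<phi> W"
    and "C \<ge> 1" and "0 < \<alpha>" and "\<alpha> < 1"
    and "\<forall>w\<in>initial_words \<Gamma>.
           inverse C * \<alpha> ^ length w \<le> diameter (moran_set \<phi> W w) \<and>
           diameter (moran_set \<phi> W w) \<le> C * \<alpha> ^ length w"
    and "A \<subseteq> \<Gamma>" and "shift_compact \<kappa> A"
  shows "assouad_dim (moran_proj \<phi> W ` A) =
         (SUP A'\<in>{A'. microset \<kappa> \<Gamma> A A'}. hausdorff_dim (moran_proj \<phi> W ` A'))"
proof -
  have compact: "compact W" using assms(7,8) by (simp add: compact_eq_bounded_closed)
  have "W \<noteq> {}" using \<open>diameter W > 0\<close> by auto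
  have cont: "continuous_on W (\<phi> a)" if "a \<in> {1..\<kappa>}" for a
  proof -
    have "\<forall>i\<in>{1..\<kappa>}. \<phi> i ` X \<subseteq> X \<and> inj_on (\<phi> i) X \<and> (\<exists>L<1. L-lipschitz_on X (\<phi> i))"
      using assms(2) unfolding conformal_ifs_def by (elim conjE)
    from bspec[OF this that] obtain L where "L-lipschitz_on X (\<phi> a)" by (elim conjE exE)
    then show ?thesis
      by (intro continuous_on_subset[OF lipschitz_on_continuous_on \<open>W \<subseteq> X\<close>])
  qed
  have inv: "\<phi> a ` W \<subseteq> W" if "a \<in> {1..\<kappa>}" for a using bspec[OF assms(10) that] .
  have diam: "inverse C * \<alpha> ^ n \<le> diameter (moran_set \<phi> W (stake n i))"
    "diameter (moran_set \<phi> W (stake n i)) \<le> C * \<alpha> ^ n" if "i \<in> \<Gamma>" for i n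
  proof -
    have "stake n i \<in> initial_words \<Gamma>" using that by (auto simp: initial_words_def)
    from bspec[OF assms(15) this]
    show "inverse C * \<alpha> ^ n \<le> diameter (moran_set \<phi> W (stake n i))"
      "diameter (moran_set \<phi> W (stake n i)) \<le> C * \<alpha> ^ n" by simp_all
  qed
  have mem: "moran_proj \<phi> W i \<in> moran_set \<phi> W (stake n i)" if "i \<in> \<Gamma>" for i n
  proof (rule moran_proj_mem[OF compact \<open>W \<noteq> {}\<close> cont inv])
    show "i \<in> shift_space \<kappa>" using that assms(3) by blast
    have lim: "(\<lambda>n. C * \<alpha> ^ n) \<longlonglongrightarrow> 0"
      using assms(13,14) by (intro tendsto_mult_right_zero LIMSEQ_power_zero) simp
    have "0 \<le> diameter (moran_set \<phi> W (stake n i))" for n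
      by (rule order_trans[OF _ diam(1)[OF that]]) (use assms(12,13) in simp)
    then show "(\<lambda>n. diameter (moran_set \<phi> W (stake n i))) \<longlonglongrightarrow> 0"
      by (intro tendsto_sandwich[OF _ _ tendsto_const lim] always_eventually allI diam(2)[OF that])
  qed
  obtain M where M_all: "\<forall>x\<in>moran_proj \<phi> W ` \<Gamma>. \<forall>r>0.
      finite (stopping_words_near \<Gamma> \<phi> W x r) \<and> card (stopping_words_near \<Gamma> \<phi> W x r) \<le> M"
    using assms(11) unfolding uniform_finite_clustering_def by (elim exE)
  have M: "finite (stopping_words_near \<Gamma> \<phi> W x r)" "card (stopping_words_near \<Gamma> \<phi> W x r) \<le> M"
    if "x \<in> moran_proj \<phi> W ` \<Gamma>" "0 < r" for x r
    using bspec[OF M_all that(1)] that(2) by simp_all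
  interpret symbolic_coding \<kappa> \<Gamma> "moran_proj \<phi> W" C \<alpha> "max 1 M"
  proof
    fix i j n assume ij: "i \<in> \<Gamma>" "j \<in> \<Gamma>" "stake n i = stake n j"
    have "moran_set \<phi> W (stake n i) \<subseteq> moran_set \<phi> W (stake 0 i)"
      using inv ij(1) assms(3) by (intro moran_set_stake_antimono[of \<kappa>]) auto
    also have "\<dots> = W" by (simp add: moran_set_def word_map_def)
    finally have "bounded (moran_set \<phi> W (stake n i))" using assms(8) bounded_subset by blast
    then have "dist (moran_proj \<phi> W i) (moran_proj \<phi> W j) \<le> diameter (moran_set \<phi> W (stake n i))"
      using mem[OF ij(1), of n] mem[OF ij(2), of n] ij(3) by (intro diameter_bounded_bound) auto
    then show "dist (moran_proj \<phi> W i) (moran_proj \<phi> W j) \<le> C * \<alpha> ^ n"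
      using diam(2)[OF ij(1), of n] by linarith
  next
    fix x r assume "x \<in> moran_proj \<phi> W ` \<Gamma>" "(0::real) < r"
    then show "\<exists>F. finite F \<and> card F \<le> max 1 M \<and> (\<forall>u\<in>F. \<alpha> ^ length u \<le> C * r) \<and>
        word_cover F {i \<in> \<Gamma>. dist x (moran_proj \<phi> W i) \<le> r}"
      using M mem by (intro clustering_word_cover[OF assms(3,12-14) bspec[OF assms(15)]])
  qed (use assms in auto)
  show ?thesis using \<open>A \<subseteq> \<Gamma>\<close> by (rule assouad_dim_image_eq_SUP_hausdorff_dim)
qed

end
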